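(* Let $\Omega\subseteq\mathbb{H}$ be a symmetric slice domain, let $V=\Omega\cap\mathbb{C}^+$ and $\Omega_i=\Omega\cap\mathbb{C}$. (a) If $f:\Omega\to\mathbb{H}$ is a regular function and $\mathcal{F}:V\to\mathrm{Gr}_2(\mathbb{C}^4)$ is its twistor transform, then $\mathcal{F}$ extends to the conjugate of $V$ by setting $\mathcal{F}(\bar v)=\sigma(\mathcal{F}(v))$, and consequently it defines a holomorphic curve $\Omega_i\to\mathrm{Gr}_2(\mathbb{C}^4)$. (b) Conversely, let $G$ be any such "real" holomorphic curve, that is, a holomorphic map $G:\Omega_i\to\mathrm{Gr}_2(\mathbb{C}^4)$ with $G(\bar v)=\sigma(G(v))$ for all $v\in\Omega_i$. If $\zeta_6\circ G$ is never zero, then $G$ (restricted to $V$) equals the twistor transform $\mathcal{F}$ of a unique regular map $f:\Omega\to\mathbb{H}$.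
   Context: $\mathbb{H}$ denotes the quaternions, $\mathbb{S}=\{q\in\mathbb{H}:q^2=-1\}$, $L_I=\mathbb{R}+I\mathbb{R}$ for $I\in\mathbb{S}$; $\mathbb{C}$ is identified with $L_i\subset\mathbb{H}$; $\mathbb{C}^+$ is the open upper half-plane. A symmetric slice domain is a domain $\Omega\subseteq\mathbb{H}$ such that $\Omega\cap\mathbb{R}\ne\emptyset$, $\Omega_I=\Omega\cap L_I$ is open and connected in $L_I$ for every $I\in\mathbb{S}$, and $\Omega$ is axially symmetric with respect to $\mathbb{R}$ (i.e. $x+yI\in\Omega$ for some $I\in\mathbb{S}$ implies $x+yI'\in\Omega$ for all $I'\in\mathbb{S}$). A function $f:\Omega\to\mathbb{H}$ is (slice) regular if for all $I\in\mathbb{S}$ the restriction $f_I=f|_{\Omega_I}$ satisfies $\frac12\left(\frac{\partial}{\partial x}+I\frac{\partial}{\partial y}\right)f_I(x+Iy)=0$ on $\Omega_I$. Twistor lift: $\mathbb{HP}^1$ is the set of classes $[q_1,q_2]=[pq_1,pq_2]$ ($p\in\mathbb{H}\setminus\{0\}$), $\mathbb{H}\subset\mathbb{HP}^1$ via $q\mapsto[1,q]$, and $\pi:\mathbb{CP}^3\to\mathbb{HP}^1$, $\pi[Z_0,Z_1,Z_2,Z_3]=[Z_0+Z_1j,Z_2+Z_3j]$. For $v\in\mathbb{C}^+$ let $\ell_v=\{[1,u,v,uv]:u\in\mathbb{C}\cup\{\infty\}\}$, a line in $\mathbb{CP}^3$ ($u=\infty$ means $[0,1,0,v]$); $\pi$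 maps $\bigcup_{v\in V}\ell_v$ bijectively onto $\Omega\setminus\mathbb{R}$. A regular $f$ on $\Omega$ can be written $f(v)=g(v)+h(v)j$ on $\Omega_i$ with $g,h:\Omega_i\to\mathbb{C}$ holomorphic; with $\hat g(z)=\overline{g(\bar z)}$, $\hat h(z)=\overline{h(\bar z)}$, its twistor lift is $F[1,u,v,uv]=[1,u,g(v)-u\hat h(v),h(v)+u\hat g(v)]$, defined on $\bigcup_{v\in V}\ell_v$ (with $F[0,1,0,v]=[0,1,-\hat h(v),\hat g(v)]$), and it satisfies $\pi\circ F=f\circ\pi$. $F$ maps each $\ell_v$ onto a line of $\mathbb{CP}^3$. $\mathrm{Gr}_2(\mathbb{C}^4)$ is the Grassmannian of lines in $\mathbb{CP}^3$. The twistor transform of $f$ is $\mathcal{F}:V\to\mathrm{Gr}_2(\mathbb{C}^4)$, $\mathcal{F}(v)=F(\ell_v)$. Coordinates: $\mathrm{Gr}_2(\mathbb{C}^4)$ is embedded in $\mathbb{CP}^5=\mathbb{P}(\bigwedge^2\mathbb{C}^4)$ (as the Klein quadric $\zeta_1\zeta_6-\zeta_2\zeta_5+\zeta_3\zeta_4=0$) by sending a line defined by two linear equations $\sum a_kZ_k=0$, $\sum b_kZ_k=0$ to the class of the wedge of the coefficient vectors $a\wedge b$, with coordinates $[\zeta_1,\dots,\zeta_6]$ relative to the basis $e^{01},e^{02},e^{03},e^{12},e^{13},e^{23}$ (i.e. the coefficient of $e^{kl}$ is $a_kb_l-a_lb_k$). The condition $\zeta_6\neq0$ means that the line does not meet $\pi^{-1}(\infty)=\{Z_0=Z_1=0\}$.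 The real structure $\sigma$ on $\mathbb{CP}^5$, which preserves $\mathrm{Gr}_2(\mathbb{C}^4)$, is $\sigma[\zeta_1,\zeta_2,\zeta_3,\zeta_4,\zeta_5,\zeta_6]=[\bar\zeta_1,\bar\zeta_5,-\bar\zeta_4,-\bar\zeta_3,\bar\zeta_2,\bar\zeta_6]$; it is induced by $[Z_0,Z_1,Z_2,Z_3]\mapsto[-\bar Z_1,\bar Z_0,-\bar Z_3,\bar Z_2]$. *)

theory Defs
  imports "HOL-Complex_Analysis.Complex_Analysis"
begin

no_notation fps_nth (infixl "$" 75)

section \<open>Quaternions\<close>

datatype quat = Quat (qre: real) (qim_i: real) (qim_j: real) (qim_k: real)

lemma quat_eq_iff:
  "p = q \<longleftrightarrow> qre p = qre q \<and> qim_i p = qim_i q \<and> qim_j p = qim_j q \<and> qim_k p = qim_k q"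
  by (cases p; cases q) auto

instantiation quat :: real_vector
begin

definition zero_quat :: quat where "0 = Quat 0 0 0 0"

definition plus_quat :: "quat \<Rightarrow> quat \<Rightarrow> quat" where
  "p + q = Quat (qre p + qre q) (qim_i p + qim_i q) (qim_j p + qim_j q) (qim_k p + qim_k q)"

definition uminus_quat :: "quat \<Rightarrow> quat" where
  "- p = Quat (- qre p) (- qim_i p) (- qim_j p) (- qim_k p)"

definition minus_quat :: "quat \<Rightarrow> quat \<Rightarrow> quat" where
  "p - q = Quat (qre p - qre q) (qim_i p - qim_i q) (qim_j p - qim_j q) (qim_k p - qim_k q)"

definition scaleR_quat :: "real \<Rightarrow> quat \<Rightarrow> quat" where
  "r *\<^sub>R p = Quat (r * qre p) (r * qim_i p) (r * qim_j p) (r * qim_k p)"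

instance
  by standard
    (simp_all add: quat_eq_iff zero_quat_def plus_quat_def uminus_quat_def minus_quat_def
      scaleR_quat_def algebra_simps)

end

instantiation quat :: real_normed_vector
begin

definition norm_quat :: "quat \<Rightarrow> real" where
  "norm p = sqrt ((qre p)\<^sup>2 + (qim_i p)\<^sup>2 + (qim_j p)\<^sup>2 + (qim_k p)\<^sup>2)"

definition sgn_quat :: "quat \<Rightarrow> quat" where
  "sgn (p::quat) = p /\<^sub>R norm p"

definition dist_quat :: "quat \<Rightarrow> quat \<Rightarrow> real" where
  "dist (p::quat) q = norm (p - q)"

definition uniformity_quat :: "(quat \<times> quat) filter" where
  "uniformity = (INF e\<in>{0<..}. principal {(p::quat, q::quat). dist p q < e})"

definition open_quat :: "quat set \<Rightarrow> bool" where
  "open (U::quat set) \<longleftrightarrow> (\<forall>x\<in>U. eventually (\<lambda>(x', y). x' = x \<longrightarrow> y \<in> U) uniformity)"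

instance
proof
  fix p q :: quat and r :: real
  show "norm p = 0 \<longleftrightarrow> p = 0"
    by (auto simp: norm_quat_def quat_eq_iff zero_quat_def add_nonneg_eq_0_iff)
  have n: "norm x = norm (((qre x, qim_i x), (qim_j x, qim_k x)))" for x :: quat
    by (simp add: norm_quat_def norm_prod_def algebra_simps)
  show "norm (p + q) \<le> norm p + norm q"
    unfolding n using norm_triangle_ineq[of "((qre p, qim_i p), (qim_j p, qim_k p))"
        "((qre q, qim_i q), (qim_j q, qim_k q))"] by (simp add: plus_quat_def)
  show "norm (r *\<^sub>R p) = \<bar>r\<bar> * norm p"
    unfolding n using norm_scaleR[of r "((qre p, qim_i p), (qim_j p, qim_k p))"]
    by (simp add: scaleR_quat_def)
qed (rule sgn_quat_def dist_quat_def uniformity_quat_def open_quat_def)+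

end

instantiation quat :: real_inner
begin

definition inner_quat :: "quat \<Rightarrow> quat \<Rightarrow> real" where
  "inner p q = qre p * qre q + qim_i p * qim_i q + qim_j p * qim_j q + qim_k p * qim_k q"

instance
proof
  fix p q s :: quat and r :: real
  show "inner p q = inner q p"
    by (simp add: inner_quat_def)
  show "inner (p + q) s = inner p s + inner q s"
    by (simp add: inner_quat_def plus_quat_def algebra_simps)
  show "inner (r *\<^sub>R p) q = r * inner p q"
    by (simp add: inner_quat_def scaleR_quat_def algebra_simps)
  show "0 \<le> inner p p"
    by (simp add: inner_quat_def)
  show "inner p p = 0 \<longleftrightarrow> p = 0"
    by (auto simp: inner_quat_def quat_eq_iff zero_quat_def add_nonneg_eq_0_iff)
  show "norm p = sqrt (inner p p)"
    by (simp add: inner_quat_def norm_quat_def power2_eq_square)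
qed

end

instantiation quat :: real_normed_div_algebra
begin

definition one_quat :: quat where "1 = Quat 1 0 0 0"

definition times_quat :: "quat \<Rightarrow> quat \<Rightarrow> quat" where
  "p * q = Quat
     (qre p * qre q - qim_i p * qim_i q - qim_j p * qim_j q - qim_k p * qim_k q)
     (qre p * qim_i q + qim_i p * qre q + qim_j p * qim_k q - qim_k p * qim_j q)
     (qre p * qim_j q - qim_i p * qim_k q + qim_j p * qre q + qim_k p * qim_i q)
     (qre p * qim_k q + qim_i p * qim_j q - qim_j p * qim_i q + qim_k p * qre q)"

definition inverse_quat :: "quat \<Rightarrow> quat" where
  "inverse p = Quat (qre p) (- qim_i p) (- qim_j p) (- qim_k p) /\<^sub>R inner p p"

definition divide_quat :: "quat \<Rightarrow> quat \<Rightarrow> quat" where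
  "p div q = p * inverse q" for p q :: quat

instance
proof
  fix p q s :: quat and r :: real
  show "p * q * s = p * (q * s)"
    by (simp add: quat_eq_iff times_quat_def algebra_simps)
  show "1 * p = p" "p * 1 = p"
    by (simp_all add: quat_eq_iff times_quat_def one_quat_def)
  show "(p + q) * s = p * s + q * s" "s * (p + q) = s * p + s * q"
    by (simp_all add: quat_eq_iff times_quat_def plus_quat_def algebra_simps)
  show "(r *\<^sub>R p) * q = r *\<^sub>R (p * q)" "p * (r *\<^sub>R q) = r *\<^sub>R (p * q)"
    by (simp_all add: quat_eq_iff times_quat_def scaleR_quat_def algebra_simps)
  show "(0::quat) \<noteq> 1"
    by (simp add: quat_eq_iff zero_quat_def one_quat_def)
  show "p div q = p * inverse q"
    by (rule divide_quat_def)
  show "inverse (0::quat) = 0"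
    by (simp add: quat_eq_iff zero_quat_def inverse_quat_def scaleR_quat_def)
  show "norm (p * q) = norm p * norm q"
    unfolding norm_quat_def real_sqrt_mult[symmetric]
    by (rule arg_cong[of _ _ sqrt]) (simp add: times_quat_def power2_eq_square algebra_simps)
  assume "p \<noteq> 0"
  then have nz: "inner p p \<noteq> 0" by simp
  have "Quat (qre p) (- qim_i p) (- qim_j p) (- qim_k p) * p = inner p p *\<^sub>R 1"
       "p * Quat (qre p) (- qim_i p) (- qim_j p) (- qim_k p) = inner p p *\<^sub>R 1"
    by (simp_all add: quat_eq_iff times_quat_def one_quat_def scaleR_quat_def inner_quat_def
        algebra_simps)
  moreover have "(a /\<^sub>R t) * b = (a * b) /\<^sub>R t" "b * (a /\<^sub>R t) = (b * a) /\<^sub>R t" for a b :: quat and t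
    by (simp_all add: quat_eq_iff times_quat_def scaleR_quat_def algebra_simps)
  ultimately show "inverse p * p = 1" "p * inverse p = 1"
    using nz by (simp_all add: inverse_quat_def)
qed

end

definition quat_j :: quat where "quat_j = Quat 0 0 1 0"

text \<open>The identification of the complex plane with the slice through the quaternion \<open>i\<close>.\<close>

definition quat_of_complex :: "complex \<Rightarrow> quat" where
  "quat_of_complex z = Quat (Re z) (Im z) 0 0"

definition fst_comp :: "quat \<Rightarrow> complex" where
  "fst_comp q = Complex (qre q) (qim_i q)"

definition snd_comp :: "quat \<Rightarrow> complex" where
  "snd_comp q = Complex (qim_j q) (qim_k q)"

lemma quat_split: "q = quat_of_complex (fst_comp q) + quat_of_complex (snd_comp q) * quat_j"
  by (simp add: quat_eq_iff quat_of_complex_def fst_comp_def snd_comp_def quat_j_def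
      times_quat_def plus_quat_def)


section \<open>Symmetric slice domains and slice regular functions\<close>

definition imag_units :: "quat set" where
  "imag_units = {q. q\<^sup>2 = - 1}"

definition slice_pt :: "quat \<Rightarrow> real \<times> real \<Rightarrow> quat" where
  "slice_pt I = (\<lambda>(x, y). of_real x + of_real y * I)"

definition slice :: "quat \<Rightarrow> quat set" where
  "slice I = range (slice_pt I)"

definition symmetric_slice_domain :: "quat set \<Rightarrow> bool" where
  "symmetric_slice_domain \<Omega> \<longleftrightarrow>
     open \<Omega> \<and> connected \<Omega> \<and> \<Omega> \<inter> range of_real \<noteq> {} \<and>
     (\<forall>I\<in>imag_units. openin (top_of_set (slice I)) (\<Omega> \<inter> slice I) \<and> connected (\<Omega> \<inter> slice I)) \<and>
     (\<forall>x y. \<forall>I\<in>imag_units. \<forall>I'\<in>imag_units. slice_pt I (x, y) \<in> \<Omega> \<longrightarrow> slice_pt I' (x, y) \<in> \<Omega>)"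

text \<open>As usual for holomorphy, the restriction of \<open>f\<close> to each slice is required to be real
  differentiable, so that the partial derivatives \<open>D (1, 0)\<close> and \<open>D (0, 1)\<close> make sense.
  The slice of a symmetric slice domain being open, only the values of \<open>f\<close> on \<open>\<Omega>\<close> matter.\<close>

definition slice_regular_on :: "quat set \<Rightarrow> (quat \<Rightarrow> quat) \<Rightarrow> bool" where
  "slice_regular_on \<Omega> f \<longleftrightarrow>
     (\<forall>I\<in>imag_units. \<forall>x y. slice_pt I (x, y) \<in> \<Omega> \<longrightarrow>
        (\<exists>D. ((\<lambda>p. f (slice_pt I p)) has_derivative D) (at (x, y)) \<and>
             (1/2) *\<^sub>R (D (1, 0) + I * D (0, 1)) = 0))"

text \<open>\<open>\<Omega>\<^sub>i\<close> and \<open>V\<close>, as subsets of the complex plane.\<close>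

definition complex_slice :: "quat set \<Rightarrow> complex set" where
  "complex_slice \<Omega> = {z. quat_of_complex z \<in> \<Omega>}"

definition upper_slice :: "quat set \<Rightarrow> complex set" where
  "upper_slice \<Omega> = {z \<in> complex_slice \<Omega>. Im z > 0}"


section \<open>Complex projective spaces\<close>

quotient_type (overloaded) 'n cproj = "complex ^ 'n::finite" /
  partial: "\<lambda>x y. x \<noteq> 0 \<and> y \<noteq> 0 \<and> (\<exists>c. y = c *s x)"
  morphisms proj_rep proj_class
proof (rule part_equivpI)
  show "\<exists>x. x \<noteq> (0::complex^'n) \<and> x \<noteq> 0 \<and> (\<exists>c. x = c *s x)"
    by (rule exI[of _ "1"]) (auto intro: exI[of _ 1])
  show "symp (\<lambda>x y. x \<noteq> 0 \<and> y \<noteq> (0::complex^'n) \<and> (\<exists>c. y = c *s x))"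
  proof (rule sympI, elim conjE exE)
    fix x y :: "complex^'n" and c
    assume "x \<noteq> 0" "y \<noteq> 0" and y: "y = c *s x"
    moreover from this have "c \<noteq> 0" by auto
    then have "x = inverse c *s y" by (simp add: y)
    ultimately show "y \<noteq> 0 \<and> x \<noteq> 0 \<and> (\<exists>c. x = c *s y)" by blast
  qed
  show "transp (\<lambda>x y. x \<noteq> 0 \<and> y \<noteq> (0::complex^'n) \<and> (\<exists>c. y = c *s x))"
    by (rule transpI) (metis vector_smult_assoc)
qed

lemma proj_class_eq_iff:
  fixes x y :: "complex ^ 'n"
  assumes "x \<noteq> 0" "y \<noteq> 0"
  shows "proj_class x = proj_class y \<longleftrightarrow> (\<exists>c. y = c *s x)"
proof -
  have r: "x \<noteq> 0 \<and> x \<noteq> 0 \<and> (\<exists>c. x = c *s x)" if "x \<noteq> 0" for x :: "complex ^ 'n"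
    using that by (auto intro: exI[of _ 1])
  show ?thesis
    using Quotient3_rel[OF Quotient3_cproj, of x y] r[OF assms(1)] r[OF assms(2)] by (simp add: assms)
qed

lift_definition hcoord_nonzero :: "('n::finite) cproj \<Rightarrow> 'n \<Rightarrow> bool" is "\<lambda>x k. x $ k \<noteq> 0"
  by (auto simp: fun_eq_iff)

lift_definition hcoord_ratio :: "('n::finite) cproj \<Rightarrow> 'n \<Rightarrow> 'n \<Rightarrow> complex"
  is "\<lambda>x j k. x $ j / x $ k"
  by (auto simp: fun_eq_iff)

text \<open>Holomorphy with respect to the standard affine charts: near each point the map takes its
  values in the chart where the \<open>k\<close>-th coordinate is nonzero, for some \<open>k\<close>, and is
  holomorphic in that chart.\<close>

definition holomorphic_into_cproj :: "complex set \<Rightarrow> (complex \<Rightarrow> ('n::finite) cproj) \<Rightarrow> bool" where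
  "holomorphic_into_cproj U \<phi> \<longleftrightarrow>
     (\<forall>v\<in>U. \<exists>W k. open W \<and> v \<in> W \<and> W \<subseteq> U \<and> (\<forall>w\<in>W. hcoord_nonzero (\<phi> w) k) \<and>
        (\<forall>j. (\<lambda>w. hcoord_ratio (\<phi> w) j k) holomorphic_on W))"


section \<open>Lines in projective 3-space and the Klein quadric\<close>

text \<open>The index type \<open>4\<close> consists of \<open>0, 1, 2, 3\<close>, so \<open>Z $ k\<close> is the coordinate \<open>Z\<^sub>k\<close>.
  The index type \<open>6\<close> is used with \<open>1, \<dots>, 6\<close> (where \<open>6 = 0\<close>), so \<open>\<zeta> $ k\<close> is \<open>\<zeta>\<^sub>k\<close>.\<close>

definition vec4 :: "complex \<Rightarrow> complex \<Rightarrow> complex \<Rightarrow> complex \<Rightarrow> complex ^ 4" where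
  "vec4 a b c d = (\<chi> k. if k = 0 then a else if k = 1 then b else if k = 2 then c else d)"

lemma vec4_nth [simp]:
  "vec4 a b c d $ 0 = a" "vec4 a b c d $ 1 = b" "vec4 a b c d $ 2 = c" "vec4 a b c d $ 3 = d"
  by (simp_all add: vec4_def)

definition vec6 ::
  "complex \<Rightarrow> complex \<Rightarrow> complex \<Rightarrow> complex \<Rightarrow> complex \<Rightarrow> complex \<Rightarrow> complex ^ 6" where
  "vec6 a b c d e f =
     (\<chi> k. if k = 1 then a else if k = 2 then b else if k = 3 then c else
          if k = 4 then d else if k = 5 then e else f)"

lemma vec6_nth [simp]:
  "vec6 a b c d e f $ 1 = a" "vec6 a b c d e f $ 2 = b" "vec6 a b c d e f $ 3 = c"
  "vec6 a b c d e f $ 4 = d" "vec6 a b c d e f $ 5 = e" "vec6 a b c d e f $ 6 = f"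
  by (simp_all add: vec6_def)

lemma forall_6: "(\<forall>i::6. P i) \<longleftrightarrow> P 1 \<and> P 2 \<and> P 3 \<and> P 4 \<and> P 5 \<and> P 6"
proof -
  have "i = 1 \<or> i = 2 \<or> i = 3 \<or> i = 4 \<or> i = 5 \<or> i = 6" for i :: 6
  proof (induct i)
    case (of_int z)
    then have "z = 0 \<or> z = 1 \<or> z = 2 \<or> z = 3 \<or> z = 4 \<or> z = 5" by simp linarith
    then show ?case by auto
  qed
  then show ?thesis by metis
qed

text \<open>The Grassmannian: projectivisations of the 2-dimensional subspaces of \<open>\<complex>\<^sup>4\<close>.\<close>

definition Gr2 :: "4 cproj set set" where
  "Gr2 = {{proj_class Z | Z. Z \<in> W \<and> Z \<noteq> 0} | W. vec.subspace W \<and> vec.dim W = 2}"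

definition line_of_eqs :: "complex ^ 4 \<Rightarrow> complex ^ 4 \<Rightarrow> 4 cproj set" where
  "line_of_eqs a b =
     {proj_class Z | Z. Z \<noteq> 0 \<and> (\<Sum>k\<in>UNIV. a $ k * Z $ k) = 0 \<and> (\<Sum>k\<in>UNIV. b $ k * Z $ k) = 0}"

definition wedge :: "complex ^ 4 \<Rightarrow> complex ^ 4 \<Rightarrow> complex ^ 6" where
  "wedge a b =
     (let m = (\<lambda>k l. a $ k * b $ l - a $ l * b $ k)
      in vec6 (m 0 1) (m 0 2) (m 0 3) (m 1 2) (m 1 3) (m 2 3))"

text \<open>The embedding of the Grassmannian as the Klein quadric. The condition \<open>wedge a b \<noteq> 0\<close>
  says that \<open>a\<close> and \<open>b\<close> are linearly independent.\<close>

definition klein :: "4 cproj set \<Rightarrow> 6 cproj" where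
  "klein L = (THE p. \<exists>a b. wedge a b \<noteq> 0 \<and> L = line_of_eqs a b \<and> p = proj_class (wedge a b))"

lemma mem_line_of_eqs:
  assumes "Z \<noteq> 0"
  shows "proj_class Z \<in> line_of_eqs a b \<longleftrightarrow>
     (\<Sum>k\<in>UNIV. a $ k * Z $ k) = 0 \<and> (\<Sum>k\<in>UNIV. b $ k * Z $ k) = 0" (is "_ = ?R Z")
proof
  assume "proj_class Z \<in> line_of_eqs a b"
  then obtain Y where Y: "Y \<noteq> 0" "proj_class Y = proj_class Z" "?R Y"
    by (auto simp: line_of_eqs_def)
  then obtain c where "Z = c *s Y" using proj_class_eq_iff assms by blast
  then have "(\<Sum>k\<in>UNIV. e $ k * Z $ k) = c * (\<Sum>k\<in>UNIV. e $ k * Y $ k)" for e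
    by (simp add: sum_distrib_left algebra_simps)
  then show "?R Z" using Y by simp
next
  assume "?R Z"
  then show "proj_class Z \<in> line_of_eqs a b"
    unfolding line_of_eqs_def using assms by blast
qed

lemma klein_line_of_eqs:
  assumes w: "wedge a b \<noteq> 0"
  shows "klein (line_of_eqs a b) = proj_class (wedge a b)"
  unfolding klein_def
proof (rule the_equality)
  show "\<exists>a' b'. wedge a' b' \<noteq> 0 \<and> line_of_eqs a b = line_of_eqs a' b' \<and>
          proj_class (wedge a b) = proj_class (wedge a' b')"
    by (intro exI conjI) (rule w refl)+
next
  fix p assume "\<exists>c d. wedge c d \<noteq> 0 \<and> line_of_eqs a b = line_of_eqs c d \<and> p = proj_class (wedge c d)"
  then obtain c d where cd: "wedge c d \<noteq> 0" and eq: "line_of_eqs a b = line_of_eqs c d"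
    and p: "p = proj_class (wedge c d)"
    by (elim exE conjE) (rule that)
  define m where "m k l = a $ k * b $ l - a $ l * b $ k" for k l
  have e: "e $ q * m r s - e $ r * m q s + e $ s * m q r = 0"
    if e: "e = c \<or> e = d" and qrs: "q \<noteq> r" "r \<noteq> s" "q \<noteq> s" for e :: "complex^4" and q r s
  proof -
    define Z where "Z = (\<chi> k. if k = q then m r s else if k = r then - m q s else if k = s then m q r else 0)"
    have S: "(\<Sum>k\<in>UNIV. x $ k * Z $ k) = x $ q * m r s - x $ r * m q s + x $ s * m q r" for x
    proof -
      have "(\<Sum>k\<in>UNIV. x $ k * Z $ k) = (\<Sum>k\<in>{q,r,s}. x $ k * Z $ k)"
        by (rule sum.mono_neutral_right) (auto simp: Z_def)
      then show ?thesis using qrs by (simp add: Z_def)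
    qed
    show ?thesis
    proof (cases "Z = 0")
      case True then show ?thesis using S[of e] by simp
    next
      case False
      have "proj_class Z \<in> line_of_eqs a b"
        by (simp add: mem_line_of_eqs[OF False] S) (simp add: m_def algebra_simps)
      then have "proj_class Z \<in> line_of_eqs c d" by (simp add: eq)
      with e show ?thesis by (auto simp: mem_line_of_eqs[OF False] S)
    qed
  qed
  define n where "n k l = c $ k * d $ l - c $ l * d $ k" for k l
  obtain q r where qr: "m q r \<noteq> 0" 
    using w by (auto simp: wedge_def Let_def vec_eq_iff forall_6 m_def)
  then have qner: "q \<noteq> r" by (auto simp: m_def)
  define \<alpha> where "\<alpha> x = (x $ q * b $ r - x $ r * b $ q) / m q r" for x :: "complex^4"
  define \<beta> where "\<beta> x = (a $ q * x $ r - a $ r * x $ q) / m q r" for x :: "complex^4"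
  have lin: "x $ s = \<alpha> x * a $ s + \<beta> x * b $ s" if "x = c \<or> x = d" for x s
  proof -
    have "x $ q * m r s - x $ r * m q s + x $ s * m q r = 0"
    proof (cases "s = q \<or> s = r")
      case True
      then show ?thesis by (auto simp: m_def algebra_simps)
    next
      case False
      then show ?thesis using e[OF that, of q r s] qner by auto
    qed
    then have "x $ s * m q r = (x $ q * b $ r - x $ r * b $ q) * a $ s + (a $ q * x $ r - a $ r * x $ q) * b $ s"
      unfolding m_def by (simp add: algebra_simps)
    then have "x $ s = ((x $ q * b $ r - x $ r * b $ q) * a $ s + (a $ q * x $ r - a $ r * x $ q) * b $ s) / m q r"
      using qr by (simp only: nonzero_eq_divide_eq[OF qr])
    then show ?thesis by (simp only: \<alpha>_def \<beta>_def add_divide_distrib times_divide_eq_left)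
  qed
  have "n k l = (\<alpha> c * \<beta> d - \<beta> c * \<alpha> d) * m k l" for k l
  proof -
    have L: "c $ k = \<alpha> c * a $ k + \<beta> c * b $ k" "c $ l = \<alpha> c * a $ l + \<beta> c * b $ l"
      "d $ k = \<alpha> d * a $ k + \<beta> d * b $ k" "d $ l = \<alpha> d * a $ l + \<beta> d * b $ l"
      using lin[of c k] lin[of c l] lin[of d k] lin[of d l] by blast+
    define A1 A2 B1 B2 where "A1 = \<alpha> c" "A2 = \<alpha> d" "B1 = \<beta> c" "B2 = \<beta> d"
    note D = this
    have "(A1 * x + B1 * y) * (A2 * z + B2 * t) - (A1 * z + B1 * t) * (A2 * x + B2 * y)
       = (A1 * B2 - B1 * A2) * (x * t - z * y)" for x y z t
      by (simp add: algebra_simps)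
    then show ?thesis unfolding n_def m_def L D by simp
  qed
  then obtain t where t: "n k l = t * m k l" for k l by blast
  have "wedge c d = t *s wedge a b"
    using t unfolding n_def m_def by (simp add: wedge_def Let_def vec_eq_iff forall_6)
  then show "p = proj_class (wedge a b)"
    using proj_class_eq_iff[OF w cd] p by auto
qed

lift_definition sigma_P5 :: "6 cproj \<Rightarrow> 6 cproj"
  is "\<lambda>\<zeta>. vec6 (cnj (\<zeta> $ 1)) (cnj (\<zeta> $ 5)) (- cnj (\<zeta> $ 4)) (- cnj (\<zeta> $ 3)) (cnj (\<zeta> $ 2)) (cnj (\<zeta> $ 6))"
proof (elim conjE exE, intro conjI)
  fix x y :: "complex ^ 6" and c
  assume "x \<noteq> 0" "y \<noteq> 0" and y: "y = c *s x"
  then show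
    "vec6 (cnj (x $ 1)) (cnj (x $ 5)) (- cnj (x $ 4)) (- cnj (x $ 3)) (cnj (x $ 2)) (cnj (x $ 6)) \<noteq> 0"
    "vec6 (cnj (y $ 1)) (cnj (y $ 5)) (- cnj (y $ 4)) (- cnj (y $ 3)) (cnj (y $ 2)) (cnj (y $ 6)) \<noteq> 0"
    by (auto simp: vec_eq_iff forall_6)
  show "\<exists>d. vec6 (cnj (y $ 1)) (cnj (y $ 5)) (- cnj (y $ 4)) (- cnj (y $ 3)) (cnj (y $ 2)) (cnj (y $ 6)) =
     d *s vec6 (cnj (x $ 1)) (cnj (x $ 5)) (- cnj (x $ 4)) (- cnj (x $ 3)) (cnj (x $ 2)) (cnj (x $ 6))"
    by (rule exI[of _ "cnj c"]) (simp add: y vec_eq_iff forall_6)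
qed

text \<open>Holomorphy of a map into the Grassmannian refers to the complex structure it has as a
  submanifold of \<open>\<complex>\<P>\<^sup>5\<close>.\<close>

definition holomorphic_curve :: "complex set \<Rightarrow> (complex \<Rightarrow> 4 cproj set) \<Rightarrow> bool" where
  "holomorphic_curve U G \<longleftrightarrow> (\<forall>v\<in>U. G v \<in> Gr2) \<and> holomorphic_into_cproj U (\<lambda>v. klein (G v))"

definition real_holomorphic_curve :: "complex set \<Rightarrow> (complex \<Rightarrow> 4 cproj set) \<Rightarrow> bool" where
  "real_holomorphic_curve U G \<longleftrightarrow>
     holomorphic_curve U G \<and> (\<forall>v\<in>U. klein (G (cnj v)) = sigma_P5 (klein (G v)))"


section \<open>Twistor lift and twistor transform\<close>

text \<open>The point \<open>[1, u, v, uv]\<close>, and its limit for \<open>u = \<infinity>\<close>.\<close>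

definition ell_pt :: "complex \<Rightarrow> complex \<Rightarrow> 4 cproj" where
  "ell_pt v u = proj_class (vec4 1 u v (u * v))"

definition ell_pt_inf :: "complex \<Rightarrow> 4 cproj" where
  "ell_pt_inf v = proj_class (vec4 0 1 0 v)"

definition ell :: "complex \<Rightarrow> 4 cproj set" where
  "ell v = insert (ell_pt_inf v) (range (ell_pt v))"

definition hat :: "(complex \<Rightarrow> complex) \<Rightarrow> complex \<Rightarrow> complex" where
  "hat g z = cnj (g (cnj z))"

text \<open>The lift is defined on the points of the lines \<open>ell v\<close> with \<open>Im v > 0\<close> and \<open>v \<in> \<Omega>\<^sub>i\<close>;
  \<open>u\<close> and \<open>v\<close> are determined by the point.\<close>

definition twistor_lift :: "quat set \<Rightarrow> (quat \<Rightarrow> quat) \<Rightarrow> 4 cproj \<Rightarrow> 4 cproj" where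
  "twistor_lift \<Omega> f p =
     (let g = (\<lambda>v. fst_comp (f (quat_of_complex v)));
          h = (\<lambda>v. snd_comp (f (quat_of_complex v)))
      in THE r. \<exists>v\<in>upper_slice \<Omega>.
           (\<exists>u. p = ell_pt v u \<and>
                r = proj_class (vec4 1 u (g v - u * hat h v) (h v + u * hat g v))) \<or>
           (p = ell_pt_inf v \<and> r = proj_class (vec4 0 1 (- hat h v) (hat g v))))"

definition twistor_transform :: "quat set \<Rightarrow> (quat \<Rightarrow> quat) \<Rightarrow> complex \<Rightarrow> 4 cproj set" where
  "twistor_transform \<Omega> f v = twistor_lift \<Omega> f ` ell v"

end

theory Submission
  imports Defs
begin

text \<open>
  Write \<open>g'\<close>, \<open>h'\<close> for \<open>hat g\<close>, \<open>hat h\<close>. The twistor transform of \<open>f = g + h j\<close> sends \<open>v\<close> to the line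
  \<open>Z\<^sub>2 = g Z\<^sub>0 - h' Z\<^sub>1\<close>, \<open>Z\<^sub>3 = h Z\<^sub>0 + g' Z\<^sub>1\<close> with Klein coordinates
  \<open>[g g' + h h', h, -g, g', h', 1]\<close>, a formula that makes sense on all of \<open>\<Omega>\<^sub>i\<close> and is
  visibly real and holomorphic. Conversely, a line with \<open>\<zeta>\<^sub>6 \<noteq> 0\<close> is the graph given by the ratios
  \<open>\<zeta>\<^sub>k / \<zeta>\<^sub>6\<close>, reality forces these to have the above shape, and \<open>g + h j\<close> extends to a regular
  function by the representation formula
  \<open>f(x + y I) = (1 - I i)/2 F(x + y i) + (1 + I i)/2 F(x - y i)\<close>. Uniqueness is the identity
  principle, applied first on the slice through \<open>i\<close> and then, from the real points, on every slice.
\<close>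

section \<open>Slices\<close>

lemma quat_simps [simp]:
  "qre (p + q) = qre p + qre q" "qim_i (p + q) = qim_i p + qim_i q"
  "qim_j (p + q) = qim_j p + qim_j q" "qim_k (p + q) = qim_k p + qim_k q"
  "qre (- p) = - qre p" "qim_i (- p) = - qim_i p" "qim_j (- p) = - qim_j p" "qim_k (- p) = - qim_k p"
  "qre (p - q) = qre p - qre q" "qim_i (p - q) = qim_i p - qim_i q"
  "qim_j (p - q) = qim_j p - qim_j q" "qim_k (p - q) = qim_k p - qim_k q"
  "qre (r *\<^sub>R p) = r * qre p" "qim_i (r *\<^sub>R p) = r * qim_i p"
  "qim_j (r *\<^sub>R p) = r * qim_j p" "qim_k (r *\<^sub>R p) = r * qim_k p"
  "qre 0 = 0" "qim_i 0 = 0" "qim_j 0 = 0" "qim_k 0 = 0"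
  "qre 1 = 1" "qim_i 1 = 0" "qim_j 1 = 0" "qim_k 1 = 0"
  by (simp_all add: plus_quat_def uminus_quat_def minus_quat_def scaleR_quat_def zero_quat_def
      one_quat_def)

lemma quat_of_real_simps [simp]:
  "qre (of_real r) = r" "qim_i (of_real r) = 0" "qim_j (of_real r) = 0" "qim_k (of_real r) = 0"
  by (simp_all add: of_real_def)

text \<open>The imaginary part of a square is twice the real part times the imaginary part, so a
  nonzero real part would leave a real number whose square is -1.\<close>

lemma imag_units_iff:
  "I \<in> imag_units \<longleftrightarrow> qre I = 0 \<and> (qim_i I)\<^sup>2 + (qim_j I)\<^sup>2 + (qim_k I)\<^sup>2 = 1"
proof
  assume "I \<in> imag_units"
  then have *: "qre I * qre I - qim_i I * qim_i I - qim_j I * qim_j I - qim_k I * qim_k I = - 1"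
    "qre I * qim_i I = 0" "qre I * qim_j I = 0" "qre I * qim_k I = 0"
    by (auto simp: imag_units_def power2_eq_square quat_eq_iff times_quat_def algebra_simps)
  have "qre I = 0"
  proof (rule ccontr)
    assume "qre I \<noteq> 0"
    with * have "qre I * qre I = - 1" by auto
    then show False using zero_le_square[of "qre I"] by linarith
  qed
  with * show "qre I = 0 \<and> (qim_i I)\<^sup>2 + (qim_j I)\<^sup>2 + (qim_k I)\<^sup>2 = 1"
    by (simp add: power2_eq_square)
next
  assume "qre I = 0 \<and> (qim_i I)\<^sup>2 + (qim_j I)\<^sup>2 + (qim_k I)\<^sup>2 = 1"
  then show "I \<in> imag_units"
    by (auto simp: imag_units_def power2_eq_square quat_eq_iff times_quat_def algebra_simps)
qed

lemma imag_unit_square: "I \<in> imag_units \<Longrightarrow> I * I = - 1"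
  by (simp add: imag_units_def power2_eq_square)

lemma norm_imag_unit: "I \<in> imag_units \<Longrightarrow> norm I = 1"
  by (simp add: imag_units_iff norm_quat_def)

lemma slice_pt_Pair: "slice_pt I (x, y) = of_real x + of_real y * I"
  by (simp add: slice_pt_def)

lemma of_real_mult_quat: "of_real r * (q::quat) = r *\<^sub>R q"
  by (simp add: scaleR_conv_of_real)

lemma imag_unit_i [simp]: "quat_of_complex \<i> \<in> imag_units"
  by (simp add: imag_units_iff quat_of_complex_def)

lemma imag_unit_minus: "I \<in> imag_units \<Longrightarrow> - I \<in> imag_units"
  by (simp add: imag_units_def)

lemma slice_pt_i: "slice_pt (quat_of_complex \<i>) (x, y) = quat_of_complex (Complex x y)"
  by (simp add: slice_pt_Pair of_real_mult_quat quat_eq_iff quat_of_complex_def)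

lemma slice_pt_minus: "slice_pt (- I) (x, y) = slice_pt I (x, - y)"
  by (simp add: slice_pt_Pair)

text \<open>Normalising the imaginary part gives the unit; a real quaternion lies on every slice,
  and the one through i is taken.\<close>

lemma quat_in_slice:
  obtains I x y where "I \<in> imag_units" "q = slice_pt I (x, y)"
proof -
  define v where "v = q - of_real (qre q)"
  show thesis
  proof (cases "v = 0")
    case True
    then show thesis
      by (intro that[of "quat_of_complex \<i>" "qre q" 0]) (auto simp: slice_pt_Pair v_def)
  next
    case False
    have "norm v * norm v = (qim_i q)\<^sup>2 + (qim_j q)\<^sup>2 + (qim_k q)\<^sup>2"
      by (simp add: norm_quat_def v_def)
    then have "inverse (norm v * norm v) * ((qim_i q)\<^sup>2 + (qim_j q)\<^sup>2 + (qim_k q)\<^sup>2) = 1"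
      using False by (metis left_inverse mult_eq_0_iff norm_eq_zero)
    then have "inverse (norm v) *\<^sub>R v \<in> imag_units"
      by (simp add: imag_units_iff v_def power2_eq_square algebra_simps)
    then show thesis
      by (rule that[of _ "qre q" "norm v"])
        (use False in \<open>simp add: slice_pt_Pair of_real_mult_quat v_def\<close>)
  qed
qed

lemma bounded_linear_quat_of_complex: "bounded_linear quat_of_complex"
  by (rule bounded_linear_intro[where K = 1])
    (auto simp: quat_of_complex_def quat_eq_iff norm_quat_def cmod_def)

lemma bounded_linear_fst_comp: "bounded_linear fst_comp"
  by (rule bounded_linear_intro[where K = 1])
    (auto simp: fst_comp_def complex_eq_iff norm_quat_def cmod_def)

lemma fst_comp_quat_of_complex [simp]: "fst_comp (quat_of_complex z) = z"
  by (simp add: fst_comp_def quat_of_complex_def complex_eq_iff)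

section \<open>Topology of the complex slice of a symmetric slice domain\<close>

context
  fixes \<Omega> :: "quat set"
  assumes dom: "symmetric_slice_domain \<Omega>"
begin

text \<open>Axial symmetry: membership on any slice is decided on the slice through i, so every
  slice has the same planar domain \<open>complex_slice \<Omega>\<close>.\<close>

lemma slice_pt_mem_iff:
  assumes "I \<in> imag_units"
  shows "slice_pt I (x, y) \<in> \<Omega> \<longleftrightarrow> Complex x y \<in> complex_slice \<Omega>"
  using dom assms imag_unit_i unfolding symmetric_slice_domain_def complex_slice_def mem_Collect_eq
    slice_pt_i[symmetric] by blast

text \<open>Conjugation amounts to replacing i by -i, which is again an imaginary unit.\<close>

lemma cnj_mem_complex_slice: "z \<in> complex_slice \<Omega> \<Longrightarrow> cnj z \<in> complex_slice \<Omega>"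
  using slice_pt_mem_iff[OF imag_unit_i, of "Re z" "- Im z"]
    slice_pt_mem_iff[OF imag_unit_minus[OF imag_unit_i], of "Re z" "Im z"]
  by (cases z) (simp add: slice_pt_minus complex_cnj)

lemma open_complex_slice: "open (complex_slice \<Omega>)"
proof -
  have "open (quat_of_complex -` \<Omega>)"
    using dom linear_continuous_on[OF bounded_linear_quat_of_complex]
    by (intro open_vimage) (auto simp: symmetric_slice_domain_def)
  then show ?thesis by (simp add: complex_slice_def vimage_def)
qed

lemma connected_complex_slice: "connected (complex_slice \<Omega>)"
proof -
  have "complex_slice \<Omega> = fst_comp ` (\<Omega> \<inter> slice (quat_of_complex \<i>))"
  proof (intro set_eqI iffI)
    fix z assume "z \<in> complex_slice \<Omega>"
    then have "quat_of_complex z \<in> \<Omega> \<inter> slice (quat_of_complex \<i>)"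
      using slice_pt_i[of "Re z" "Im z"]
      by (auto simp: complex_slice_def slice_def) (metis rangeI)
    then show "z \<in> fst_comp ` (\<Omega> \<inter> slice (quat_of_complex \<i>))"
      by (metis fst_comp_quat_of_complex image_eqI)
  qed (auto simp: complex_slice_def slice_def slice_pt_i)
  moreover have "connected (\<Omega> \<inter> slice (quat_of_complex \<i>))"
    using dom by (simp add: symmetric_slice_domain_def)
  ultimately show ?thesis
    using linear_continuous_on[OF bounded_linear_fst_comp] by (metis connected_continuous_image)
qed

lemma real_point_complex_slice:
  obtains x where "of_real x \<in> complex_slice \<Omega>"
proof -
  obtain x where "of_real x \<in> \<Omega>" using dom by (auto simp: symmetric_slice_domain_def)
  then show thesis
    by (intro that[of x]) (simp add: complex_slice_def quat_of_complex_def of_real_def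
        scaleR_quat_def one_quat_def)
qed

text \<open>Provides both accumulation sets for the identity principle: the upper half serves on the
  slice through i, the real points serve on all other slices.\<close>

lemma real_point_islimpt:
  obtains x where "of_real x \<in> complex_slice \<Omega>"
    "of_real x islimpt (complex_slice \<Omega> \<inter> \<real>)" "of_real x islimpt (upper_slice \<Omega>)"
proof -
  obtain x where x: "of_real x \<in> complex_slice \<Omega>" by (rule real_point_complex_slice)
  obtain e where e: "e > 0" "ball (of_real x) e \<subseteq> complex_slice \<Omega>"
    using open_complex_slice x open_contains_ball by blast
  have "\<exists>y\<in>complex_slice \<Omega> \<inter> \<real>. y \<noteq> of_real x \<and> dist y (of_real x) < d" if "d > 0" for d
  proof (intro bexI[of _ "of_real x + of_real (min d e / 2)"])
    show "of_real x + complex_of_real (min d e / 2) \<in> complex_slice \<Omega> \<inter> \<real>"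
      using e that by (auto intro!: subsetD[OF e(2)] simp: dist_norm simp del: of_real_divide)
  qed (use e that in \<open>auto simp: dist_norm simp del: of_real_divide\<close>)
  moreover have "\<exists>y\<in>upper_slice \<Omega>. y \<noteq> of_real x \<and> dist y (of_real x) < d" if "d > 0" for d
  proof (intro bexI[of _ "of_real x + \<i> * of_real (min d e / 2)"])
    show "of_real x + \<i> * complex_of_real (min d e / 2) \<in> upper_slice \<Omega>"
      using e that by (auto intro!: subsetD[OF e(2)] simp: upper_slice_def dist_norm norm_mult
          simp del: of_real_divide)
  qed (use e that in \<open>auto simp: dist_norm norm_mult simp del: of_real_divide\<close>)
  ultimately show thesis using x by (intro that[of x]) (auto simp: islimpt_approachable)
qed

end


section \<open>Components of slice regular functions\<close>

text \<open>Complex linear in \<open>q\<close> for the complex structure given by left multiplication by \<open>I\<close>, with real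
  part \<open>inner q c\<close>: these functionals separate points, so no splitting of the quaternions adapted
  to \<open>I\<close> is needed.\<close>

definition slice_comp :: "quat \<Rightarrow> quat \<Rightarrow> quat \<Rightarrow> complex" where
  "slice_comp I c q = Complex (inner q c) (- inner (I * q) c)"

lemma slice_comp_mult_unit:
  "I \<in> imag_units \<Longrightarrow> slice_comp I c (I * q) = \<i> * slice_comp I c q"
  by (simp add: slice_comp_def complex_eq_iff imag_unit_square flip: mult.assoc)

lemma bounded_linear_slice_comp: "bounded_linear (slice_comp I c)"
proof -
  have 1: "bounded_linear (\<lambda>q. of_real (inner q c) - \<i> * of_real (inner (I * q) c))"
    by (intro bounded_linear_sub bounded_linear_of_real[THEN bounded_linear_compose]
        bounded_linear_const_mult bounded_linear_inner_left
        bounded_linear_inner_left[THEN bounded_linear_compose] bounded_linear_mult_right)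
  moreover have "(\<lambda>q. of_real (inner q c) - \<i> * of_real (inner (I * q) c)) = slice_comp I c"
    by (auto simp: slice_comp_def complex_eq_iff)
  ultimately show ?thesis by simp
qed

text \<open>With its companion for \<open>snd_comp\<close>, this makes holomorphy of the two complex
  components of \<open>f\<close> an instance of the general statement about
  \<open>slice_comp\<close>.\<close>

lemma fst_comp_eq_slice_comp: "fst_comp = slice_comp (quat_of_complex \<i>) 1"
  by (auto simp: fun_eq_iff fst_comp_def slice_comp_def quat_of_complex_def times_quat_def
      inner_quat_def)

lemma snd_comp_eq_slice_comp: "snd_comp = slice_comp (quat_of_complex \<i>) quat_j"
  by (auto simp: fun_eq_iff snd_comp_def slice_comp_def quat_of_complex_def times_quat_def
      inner_quat_def quat_j_def)

text \<open>The Cauchy-Riemann equation says that the real derivative turns multiplication by \<i>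
  into left multiplication by \<open>I\<close>, and \<open>slice_comp I c\<close> turns it back; the
  composite derivative is thus complex linear.\<close>

lemma holomorphic_slice_comp:
  assumes dom: "symmetric_slice_domain \<Omega>" and f: "slice_regular_on \<Omega> f" and I: "I \<in> imag_units"
  shows "(\<lambda>z. slice_comp I c (f (slice_pt I (Re z, Im z)))) holomorphic_on complex_slice \<Omega>"
proof -
  have "\<exists>d. ((\<lambda>z. slice_comp I c (f (slice_pt I (Re z, Im z)))) has_field_derivative d) (at z)"
    if z: "z \<in> complex_slice \<Omega>" for z
  proof -
    have "slice_pt I (Re z, Im z) \<in> \<Omega>"
      using z slice_pt_mem_iff[OF dom I] by simp
    then obtain D where D: "((\<lambda>p. f (slice_pt I p)) has_derivative D) (at (Re z, Im z))"
      and "(1/2) *\<^sub>R (D (1, 0) + I * D (0, 1)) = 0"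
      using f I unfolding slice_regular_on_def by blast
    then have CR: "D (1, 0) + I * D (0, 1) = 0" by simp
    interpret D: bounded_linear D using D by (rule has_derivative_bounded_linear)
    interpret S: bounded_linear "slice_comp I c" by (rule bounded_linear_slice_comp)
    have "I * (D (1, 0) + I * D (0, 1)) = 0" by (simp add: CR)
    then have "I * D (1, 0) + (I * I) * D (0, 1) = 0"
      by (simp only: distrib_left mult.assoc)
    then have *: "D (0, 1) = I * D (1, 0)"
      by (simp add: imag_unit_square[OF I])
    have D_eq: "slice_comp I c (D (Re w, Im w)) = slice_comp I c (D (1, 0)) * w" for w
    proof -
      have "D (Re w, Im w) = D (Re w *\<^sub>R (1, 0) + Im w *\<^sub>R (0, 1))" by simp
      also have "\<dots> = Re w *\<^sub>R D (1, 0) + Im w *\<^sub>R (I * D (1, 0))"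
        by (simp only: D.add D.scaleR *)
      finally show ?thesis
        by (simp add: S.add S.scaleR slice_comp_mult_unit[OF I] complex_eq_iff algebra_simps)
    qed
    have "((\<lambda>z. (Re z, Im z)) has_derivative (\<lambda>w. (Re w, Im w))) (at z)"
      by (auto intro!: derivative_eq_intros)
    from S.has_derivative[OF has_derivative_compose[OF this D]]
    have "((\<lambda>z. slice_comp I c (f (slice_pt I (Re z, Im z)))) has_field_derivative
        slice_comp I c (D (1, 0))) (at z)"
      by (simp only: has_field_derivative_def D_eq)
    then show ?thesis by blast
  qed
  then show ?thesis
    using holomorphic_on_open[OF open_complex_slice[OF dom]] by blast
qed

text \<open>Identity principle. Agreement on the upper half spreads over the slice through i, hence
  to the real points, which belong to all slices, and from there over each slice.\<close>

lemma slice_regular_eqI: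
  assumes dom: "symmetric_slice_domain \<Omega>"
    and f: "slice_regular_on \<Omega> f" and f': "slice_regular_on \<Omega> f'"
    and eq: "\<And>v. v \<in> upper_slice \<Omega> \<Longrightarrow> f (quat_of_complex v) = f' (quat_of_complex v)"
    and q: "q \<in> \<Omega>"
  shows "f q = f' q"
proof -
  obtain x where x: "of_real x \<in> complex_slice \<Omega>"
    "of_real x islimpt (complex_slice \<Omega> \<inter> \<real>)" "of_real x islimpt (upper_slice \<Omega>)"
    using real_point_islimpt[OF dom] .
  have cont: "slice_comp I c (f (slice_pt I (Re z, Im z)) - f' (slice_pt I (Re z, Im z))) = 0"
    if "I \<in> imag_units" "X \<subseteq> complex_slice \<Omega>" "of_real x islimpt X" "z \<in> complex_slice \<Omega>"
      "\<And>w. w \<in> X \<Longrightarrow> f (slice_pt I (Re w, Im w)) = f' (slice_pt I (Re w, Im w))" for I c X z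
  proof -
    interpret S: bounded_linear "slice_comp I c" by (rule bounded_linear_slice_comp)
    have "slice_comp I c (f (slice_pt I (Re z, Im z))) - slice_comp I c (f' (slice_pt I (Re z, Im z))) = 0"
      by (rule analytic_continuation[where U = X and \<xi> = "of_real x" and S = "complex_slice \<Omega>"])
        (use that x dom f f' in \<open>auto intro!: holomorphic_intros holomorphic_slice_comp
          simp: open_complex_slice connected_complex_slice\<close>)
    then show ?thesis by (simp add: S.diff)
  qed
  have sl: "f (slice_pt I (Re z, Im z)) = f' (slice_pt I (Re z, Im z))"
    if "I \<in> imag_units" "X \<subseteq> complex_slice \<Omega>" "of_real x islimpt X" "z \<in> complex_slice \<Omega>"
      "\<And>w. w \<in> X \<Longrightarrow> f (slice_pt I (Re w, Im w)) = f' (slice_pt I (Re w, Im w))" for I X z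
    \<comment> \<open>With \<open>c\<close> chosen as the difference of the two values itself, the
      real part of \<open>slice_comp I c\<close> at that difference is its squared norm.\<close>
    using cont[OF that, of "f (slice_pt I (Re z, Im z)) - f' (slice_pt I (Re z, Im z))"]
    by (simp add: slice_comp_def complex_eq_iff)
  have i: "f (slice_pt (quat_of_complex \<i>) (Re z, Im z)) = f' (slice_pt (quat_of_complex \<i>) (Re z, Im z))"
    if "z \<in> complex_slice \<Omega>" for z
    by (rule sl[where X = "upper_slice \<Omega>"]) (use that x eq in \<open>auto simp: upper_slice_def slice_pt_i\<close>)
  obtain I a b where I: "I \<in> imag_units" "q = slice_pt I (a, b)" by (rule quat_in_slice)
  have "f (slice_pt I (Re (Complex a b), Im (Complex a b))) = f' (slice_pt I (Re (Complex a b), Im (Complex a b)))"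
  \<comment> \<open>At real points the imaginary unit has coefficient 0, so the slice through
    \<open>I\<close> takes over the equality known on the slice through i.\<close>
  proof (rule sl[where X = "complex_slice \<Omega> \<inter> \<real>"])
    fix w assume w: "w \<in> complex_slice \<Omega> \<inter> \<real>"
    then have "slice_pt I (Re w, Im w) = slice_pt (quat_of_complex \<i>) (Re w, Im w)"
      by (auto simp: slice_pt_Pair complex_is_Real_iff)
    then show "f (slice_pt I (Re w, Im w)) = f' (slice_pt I (Re w, Im w))" using i w by simp
  qed (use I q x slice_pt_mem_iff[OF dom] in auto)
  then show ?thesis using I by simp
qed


section \<open>The regular extension of a holomorphic map\<close>

definition slice_value :: "(complex \<Rightarrow> quat) \<Rightarrow> quat \<Rightarrow> real \<Rightarrow> real \<Rightarrow> quat" where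
  "slice_value F I x y =
     ((1/2) *\<^sub>R (1 - I * quat_of_complex \<i>)) * F (Complex x y) +
     ((1/2) *\<^sub>R (1 + I * quat_of_complex \<i>)) * F (Complex x (- y))"

text \<open>At real points the imaginary unit degenerates to \<open>0\<close>, which is harmless as
  \<open>slice_value F I x 0 = F x\<close> for every \<open>I\<close>.\<close>

definition regular_ext :: "(complex \<Rightarrow> quat) \<Rightarrow> quat \<Rightarrow> quat" where
  "regular_ext F q =
     (let v = q - of_real (qre q) in slice_value F (v /\<^sub>R norm v) (qre q) (norm v))"

text \<open>The two coefficients of the representation formula add up to 1, and at a real point both
  multiply the same value of \<open>F\<close>.\<close>

lemma slice_value_real: "slice_value F I x 0 = F (Complex x 0)"
proof -
  have "(1/2) *\<^sub>R (1 - J) + (1/2) *\<^sub>R (1 + J) = 1" for J :: quat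
    by (simp add: quat_eq_iff field_simps)
  then show ?thesis
    by (simp only: slice_value_def minus_zero distrib_right[symmetric] mult_1_left)
qed

text \<open>A point has the two descriptions \<open>(I, y)\<close> and \<open>(- I, - y)\<close>;
  passing from one to the other only swaps the two summands.\<close>

lemma slice_value_minus: "slice_value F (- I) x (- y) = slice_value F I x y"
  by (simp add: slice_value_def)

lemma regular_ext_slice_pt:
  assumes I: "I \<in> imag_units"
  shows "regular_ext F (slice_pt I (x, y)) = slice_value F I x y"
proof -
  have re: "qre (slice_pt I (x, y)) = x"
    using I by (simp add: slice_pt_Pair of_real_mult_quat imag_units_iff)
  have v: "slice_pt I (x, y) - of_real x = y *\<^sub>R I"
    by (simp add: slice_pt_Pair of_real_mult_quat)
  consider "y = 0" | "y > 0" | "y < 0" by linarith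
  then show ?thesis
  proof cases
    case 1
    then show ?thesis by (simp add: regular_ext_def Let_def re[unfolded 1] v[unfolded 1] slice_value_real)
  next
    case 2
    then show ?thesis by (simp add: regular_ext_def Let_def re v norm_imag_unit[OF I])
  next
    case 3
    then show ?thesis
      by (simp add: regular_ext_def Let_def re v norm_imag_unit[OF I] slice_value_minus)
  qed
qed

text \<open>For \<open>I\<close> equal to i the coefficients of the representation formula are 1 and
  0, so this is indeed an extension of \<open>F\<close>.\<close>

lemma regular_ext_complex: "regular_ext F (quat_of_complex z) = F z"
  using regular_ext_slice_pt[OF imag_unit_i, of F "Re z" "Im z"]
  by (simp add: slice_pt_i slice_value_def imag_unit_square)

lemma quat_of_complex_mult: "quat_of_complex (a * b) = quat_of_complex a * quat_of_complex b"
  by (simp add: quat_eq_iff quat_of_complex_def times_quat_def)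

text \<open>Left multiplication by \<open>I\<close> passes through the coefficients
  \<open>cp\<close> and \<open>cm\<close> as multiplication by i and by -i. These match the
  holomorphic dependence of the first summand and the antiholomorphic dependence of the
  second.\<close>

lemma slice_regular_regular_ext:
  assumes dom: "symmetric_slice_domain \<Omega>"
    and g: "g holomorphic_on complex_slice \<Omega>" and h: "h holomorphic_on complex_slice \<Omega>"
  shows "slice_regular_on \<Omega>
    (regular_ext (\<lambda>z. quat_of_complex (g z) + quat_of_complex (h z) * quat_j))"
    (is "slice_regular_on \<Omega> (regular_ext ?F)")
  unfolding slice_regular_on_def
proof (intro ballI allI impI)
  fix I x y assume I: "I \<in> imag_units" and mem: "slice_pt I (x, y) \<in> \<Omega>"
  interpret Q: bounded_linear quat_of_complex by (rule bounded_linear_quat_of_complex)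
  let ?i = "quat_of_complex \<i>"
  define cp where "cp = (1/2) *\<^sub>R (1 - I * ?i)"
  define cm where "cm = (1/2) *\<^sub>R (1 + I * ?i)"
  have II: "I * (I * q) = - q" "?i * (?i * q) = - q" for q
    by (simp_all add: imag_unit_square[OF I] imag_unit_square[OF imag_unit_i] flip: mult.assoc)
  have cp: "I * cp = cp * ?i" and cm: "I * cm = - (cm * ?i)"
    unfolding cp_def cm_def
    by (simp_all add: algebra_simps II imag_unit_square[OF imag_unit_i])
  \<comment> \<open>Since j stands to the right of \<open>h\<close>, the derivatives of both
    components act by complex multiplication from the left, and the quaternion \<open>M\<close>
    collects what remains on the right.\<close>
  have dF: "\<exists>M. (?F has_derivative (\<lambda>w. quat_of_complex w * M)) (at z)"
    if z: "z \<in> complex_slice \<Omega>" for z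
  proof -
    obtain g' h' where d: "(g has_derivative (\<lambda>w. g' * w)) (at z)" "(h has_derivative (\<lambda>w. h' * w)) (at z)"
      using g h z unfolding holomorphic_on_open[OF open_complex_slice[OF dom]]
        has_field_derivative_def by meson
    have "(?F has_derivative (\<lambda>w. quat_of_complex (g' * w) + quat_of_complex (h' * w) * quat_j)) (at z)"
      by (intro has_derivative_add has_derivative_mult_left Q.has_derivative d)
    then have "(?F has_derivative (\<lambda>w. quat_of_complex w *
        (quat_of_complex g' + quat_of_complex h' * quat_j))) (at z)"
      by (simp add: distrib_left mult.assoc mult.commute[of g'] mult.commute[of h'] quat_of_complex_mult)
    then show ?thesis by blast
  qed
  have "Complex x y \<in> complex_slice \<Omega>" using mem slice_pt_mem_iff[OF dom I] by blast
  moreover from cnj_mem_complex_slice[OF dom this] have "Complex x (- y) \<in> complex_slice \<Omega>"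
    by (simp add: complex_cnj)
  ultimately obtain M M' where
    M: "(?F has_derivative (\<lambda>w. quat_of_complex w * M)) (at (Complex x y))" and
    M': "(?F has_derivative (\<lambda>w. quat_of_complex w * M')) (at (Complex x (- y)))"
    using dF by meson
  have bl: "bounded_linear (\<lambda>p. Complex (fst p) (snd p))" "bounded_linear (\<lambda>p. Complex (fst p) (- snd p))"
    by (auto intro!: bounded_linear_intro[where K = 1]
        simp: complex_eq_iff cmod_def norm_prod_def)
  have d1: "((\<lambda>p. Complex (fst p) (snd p)) has_derivative (\<lambda>p. Complex (fst p) (snd p))) (at (x, y))"
    "((\<lambda>p. Complex (fst p) (- snd p)) has_derivative (\<lambda>p. Complex (fst p) (- snd p))) (at (x, y))"
    by (rule bounded_linear_imp_has_derivative, rule bl)+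
  define D where "D p = cp * (quat_of_complex (Complex (fst p) (snd p)) * M) +
    cm * (quat_of_complex (Complex (fst p) (- snd p)) * M')" for p
  have "((\<lambda>p. cp * ?F (Complex (fst p) (snd p)) + cm * ?F (Complex (fst p) (- snd p)))
      has_derivative D) (at (x, y))"
    unfolding D_def
    by (intro has_derivative_add has_derivative_mult_right has_derivative_compose[OF d1(1), of ?F]
        has_derivative_compose[OF d1(2), of ?F]) (use M M' in simp_all)
  moreover have "(\<lambda>p. regular_ext ?F (slice_pt I p)) =
      (\<lambda>p. cp * ?F (Complex (fst p) (snd p)) + cm * ?F (Complex (fst p) (- snd p)))"
    by (simp add: fun_eq_iff regular_ext_slice_pt[OF I] slice_value_def cp_def cm_def)
  ultimately have "((\<lambda>p. regular_ext ?F (slice_pt I p)) has_derivative D) (at (x, y))" by simp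
  moreover have "D (1, 0) + I * D (0, 1) = 0"
  proof -
    have "quat_of_complex (Complex 1 0) = 1" "quat_of_complex (Complex 0 1) = ?i"
      "quat_of_complex (Complex 0 (- 1)) = - ?i"
      by (simp_all add: quat_eq_iff quat_of_complex_def)
    \<comment> \<open>These identities give \<open>I * D (0, 1) = - (cp * M) - cm * M'\<close>, the
      negative of \<open>D (1, 0)\<close>; the sign in the \<open>cm\<close> term comes from the
      reflected variable.\<close>
    moreover have "I * (cp * (?i * q)) = - (cp * q)" "I * (cm * (?i * q)) = cm * q" for q
      by (simp_all add: cp cm mult.assoc II flip: mult.assoc[of I]) 
    ultimately show ?thesis
      by (simp add: D_def distrib_left right_diff_distrib)
  qed
  ultimately show "\<exists>D. ((\<lambda>p. regular_ext ?F (slice_pt I p)) has_derivative D) (at (x, y)) \<and>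
      (1/2) *\<^sub>R (D (1, 0) + I * D (0, 1)) = 0"
    by (intro exI[of _ D]) simp
qed

section \<open>Lines in projective space\<close>

text \<open>The index 4 equals 0 in this type, which lets the enumeration by 1 to 4 be replaced by
  the coordinates 0 to 3.\<close>

lemma UNIV_4_from_0: "(UNIV :: 4 set) = {0, 1, 2, 3}"
proof -
  have "(4::4) = 0" by simp
  then show ?thesis unfolding UNIV_4 by auto
qed

lemma sum_4_from_0: "(\<Sum>k\<in>UNIV. f k) = f (0::4) + f 1 + f 2 + (f 3 :: 'a::comm_monoid_add)"
  unfolding UNIV_4_from_0 by (simp add: add.assoc)

lemma forall_4_from_0: "(\<forall>k::4. P k) \<longleftrightarrow> P 0 \<and> P 1 \<and> P 2 \<and> P 3"
proof -
  have "(4::4) = 0" by simp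
  then show ?thesis unfolding forall_4 by metis
qed

lemma vec4_eq_iff: "Z = vec4 a b c d \<longleftrightarrow> Z $ 0 = a \<and> Z $ 1 = b \<and> Z $ 2 = c \<and> Z $ 3 = d"
  by (simp add: vec_eq_iff forall_4_from_0)

section \<open>Homogeneous coordinates and affine charts\<close>

lemma cproj_cases:
  obtains x where "x \<noteq> 0" "p = proj_class x"
  using Quotient3_abs_rep[OF Quotient3_cproj, of p] Quotient3_rep_reflp[OF Quotient3_cproj, of p]
  by metis

lemma hcoord_nonzero_proj_class [simp]:
  "x \<noteq> 0 \<Longrightarrow> hcoord_nonzero (proj_class x) k \<longleftrightarrow> x $ k \<noteq> 0"
  by (subst hcoord_nonzero.abs_eq) (auto intro: exI[of _ 1])

lemma hcoord_ratio_proj_class [simp]: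
  "x \<noteq> 0 \<Longrightarrow> hcoord_ratio (proj_class x) j k = x $ j / x $ k"
  by (subst hcoord_ratio.abs_eq) (auto intro: exI[of _ 1])

lemma sigma_P5_proj_class:
  "x \<noteq> 0 \<Longrightarrow> sigma_P5 (proj_class x) = proj_class (vec6 (cnj (x $ 1)) (cnj (x $ 5))
     (- cnj (x $ 4)) (- cnj (x $ 3)) (cnj (x $ 2)) (cnj (x $ 6)))"
  by (rule sigma_P5.abs_eq) (auto intro: exI[of _ 1])

text \<open>These two relations carry the whole reality condition needed later: they pair
  \<open>h\<close> with the fifth coordinate and \<open>g\<close> with the fourth. Where the sixth
  coordinate vanishes, both sides are 0 by the convention for division.\<close>

lemma hcoord_ratio_sigma_P5:
  "hcoord_ratio (sigma_P5 p) 2 6 = cnj (hcoord_ratio p 5 6)"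
  "hcoord_ratio (sigma_P5 p) 3 6 = - cnj (hcoord_ratio p 4 6)"
proof -
  obtain x where x: "x \<noteq> 0" "p = proj_class x" by (rule cproj_cases)
  have "vec6 (cnj (x $ 1)) (cnj (x $ 5)) (- cnj (x $ 4)) (- cnj (x $ 3)) (cnj (x $ 2)) (cnj (x $ 6)) \<noteq> 0"
    using x(1) by (auto simp: vec_eq_iff forall_6)
  with x show "hcoord_ratio (sigma_P5 p) 2 6 = cnj (hcoord_ratio p 5 6)"
    "hcoord_ratio (sigma_P5 p) 3 6 = - cnj (hcoord_ratio p 4 6)"
    by (simp_all add: sigma_P5_proj_class)
qed

lemma hcoord_ratio_change_chart:
  assumes "hcoord_nonzero p l"
  shows "hcoord_ratio p j k = hcoord_ratio p j l / hcoord_ratio p k l"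
    and "hcoord_nonzero p k \<Longrightarrow> hcoord_ratio p k l \<noteq> 0"
  using assms by (cases p rule: cproj_cases; simp)+

text \<open>The chart \<open>l\<close> supplied locally may differ from \<open>k\<close>; the change
  of chart is a quotient of two functions holomorphic in chart \<open>l\<close>, with nonvanishing
  denominator.\<close>

lemma holomorphic_hcoord_ratio:
  assumes hol: "holomorphic_into_cproj U \<phi>" and nz: "\<And>v. v \<in> U \<Longrightarrow> hcoord_nonzero (\<phi> v) k"
  shows "(\<lambda>v. hcoord_ratio (\<phi> v) j k) holomorphic_on U"
proof -
  have "(\<lambda>v. hcoord_ratio (\<phi> v) j k) field_differentiable at v within U" if "v \<in> U" for v
  proof -
    from hol[unfolded holomorphic_into_cproj_def, THEN bspec, OF that]
    obtain W l where W: "open W" "v \<in> W" "W \<subseteq> U"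
      and l: "\<forall>w\<in>W. hcoord_nonzero (\<phi> w) l"
      and hol_l: "\<forall>j. (\<lambda>w. hcoord_ratio (\<phi> w) j l) holomorphic_on W"
      by (elim exE conjE)
    have "hcoord_ratio (\<phi> w) k l \<noteq> 0" if "w \<in> W" for w
      using that W(3) by (intro hcoord_ratio_change_chart(2) l[rule_format] nz) auto
    then have "(\<lambda>w. hcoord_ratio (\<phi> w) j l / hcoord_ratio (\<phi> w) k l) holomorphic_on W"
      by (rule holomorphic_on_divide[OF hol_l[rule_format] hol_l[rule_format]])
    then have "(\<lambda>w. hcoord_ratio (\<phi> w) j k) holomorphic_on W"
      by (rule holomorphic_transform) (rule hcoord_ratio_change_chart(1)[symmetric, OF l[rule_format]])
    then show ?thesis
      by (rule field_differentiable_at_within[OF holomorphic_on_imp_differentiable_at[OF _ W(1,2)]])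
  qed
  then show ?thesis by (simp add: holomorphic_on_def)
qed

section \<open>Two-dimensional subspaces as solution sets of two linear equations\<close>

lemma wedge_eq_0_iff: "wedge a b = 0 \<longleftrightarrow> (\<forall>k l. a $ k * b $ l = a $ l * b $ k)"
  by (auto simp: wedge_def Let_def vec_eq_iff forall_6 forall_4_from_0)

text \<open>With \<open>\<pi> r s\<close> a nonzero Pluecker coordinate of the span of \<open>p\<close>, \<open>q\<close> and \<open>t\<close>, \<open>u\<close>
  the other two indices, the span is cut out by the minors with rows
  \<open>r, s, t\<close> and \<open>r, s, u\<close> of the matrix with columns \<open>p\<close>, \<open>q\<close>, \<open>Z\<close>.\<close>

lemma Gr2_line_of_eqs:
  assumes "L \<in> Gr2"
  obtains a b where "wedge a b \<noteq> 0" "L = line_of_eqs a b"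
proof -
  obtain W where W: "vec.subspace W" "vec.dim W = 2" "L = {proj_class Z | Z. Z \<in> W \<and> Z \<noteq> 0}"
    using assms by (auto simp: Gr2_def)
  obtain B where B: "B \<subseteq> W" "vec.independent B" "W \<subseteq> vec.span B" "card B = 2"
    using vec.basis_exists[of W] W(2) by metis
  have WB: "W = vec.span B" using B W(1) by (metis vec.span_subspace)
  obtain p q where pq: "B = {p, q}" "p \<noteq> q" using B(4) by (auto simp: card_2_iff)
  define \<pi> where "\<pi> r s = p $ r * q $ s - p $ s * q $ r" for r s
  have mem_W: "Z \<in> W \<longleftrightarrow> (\<exists>\<alpha> \<beta>. Z = \<alpha> *s p + \<beta> *s q)" for Z
  proof -
    have "Z \<in> W \<longleftrightarrow> (\<exists>\<alpha> \<beta>. Z - \<alpha> *s p = \<beta> *s q)"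
      unfolding WB pq vec.span_insert vec.span_singleton by auto
    then show ?thesis by (simp add: algebra_simps)
  qed
  \<comment> \<open>If all Pluecker coordinates vanished, \<open>q\<close> would be a multiple of
    \<open>p\<close>, against independence.\<close>
  obtain r s where rs: "\<pi> r s \<noteq> 0"
  proof (rule ccontr)
    assume "\<not> thesis"
    with that have 0: "p $ r * q $ s = p $ s * q $ r" for r s by (auto simp: \<pi>_def)
    have "p \<noteq> 0" using B(2) pq vec.dependent_zero by blast
    then obtain r where r: "p $ r \<noteq> 0" by (auto simp: vec_eq_iff)
    define c where "c = q $ r / p $ r"
    have "q $ s = c * p $ s" for s
      using 0[of r s] r by (simp add: c_def field_simps)
    then have "q = c *s p" by (simp add: vec_eq_iff)
    then have "q \<in> vec.span {p}" by (metis vec.span_base vec.span_scale insertI1)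
    moreover have "vec.independent (insert q {p})" using B(2) pq by (simp add: insert_commute)
    ultimately show False using pq by (simp add: vec.independent_insert)
  qed
  then have "r \<noteq> s" by (auto simp: \<pi>_def)
  then have "card (- {r, s}) = 2" by (simp add: Compl_eq_Diff_UNIV card_Diff_subset)
  then obtain t u where tu: "- {r, s} = {t, u}" "t \<noteq> u" by (auto simp: card_2_iff)
  have dist: "r \<noteq> s" "r \<noteq> t" "r \<noteq> u" "s \<noteq> t" "s \<noteq> u" "t \<noteq> u" using tu \<open>r \<noteq> s\<close> by auto
  have cover: "k = r \<or> k = s \<or> k = t \<or> k = u" for k using tu by auto
  define E where "E t = (\<chi> k. if k = t then \<pi> r s else if k = r then \<pi> s t
      else if k = s then \<pi> t r else 0)" for t
  have E: "(\<Sum>k\<in>UNIV. E t $ k * Z $ k) = \<pi> s t * Z $ r + \<pi> t r * Z $ s + \<pi> r s * Z $ t"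
    if "t \<noteq> r" "t \<noteq> s" for t Z
  proof -
    have "(\<Sum>k\<in>UNIV. E t $ k * Z $ k) = (\<Sum>k\<in>{r, s, t}. E t $ k * Z $ k)"
      by (rule sum.mono_neutral_right) (auto simp: E_def)
    then show ?thesis using that \<open>r \<noteq> s\<close> by (auto simp: E_def)
  qed
  have tu': "t \<noteq> r" "t \<noteq> s" "u \<noteq> r" "u \<noteq> s" using dist by auto
  \<comment> \<open>The left side is the square of \<open>\<pi> r s\<close>, while each of
    \<open>E t\<close> and \<open>E u\<close> vanishes at the index of the other.\<close>
  have "E t $ t * E u $ u \<noteq> E t $ u * E u $ t" using rs dist by (simp add: E_def)
  then have "wedge (E t) (E u) \<noteq> 0" by (auto simp: wedge_eq_0_iff)
  moreover have "Z \<in> W \<longleftrightarrow> (\<Sum>k\<in>UNIV. E t $ k * Z $ k) = 0 \<and> (\<Sum>k\<in>UNIV. E u $ k * Z $ k) = 0" for Z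
  proof
    assume "Z \<in> W"
    then obtain \<alpha> \<beta> where Z: "\<And>k. Z $ k = \<alpha> * p $ k + \<beta> * q $ k"
      using mem_W[of Z] by (metis vector_add_component vector_smult_component)
    show "(\<Sum>k\<in>UNIV. E t $ k * Z $ k) = 0 \<and> (\<Sum>k\<in>UNIV. E u $ k * Z $ k) = 0"
      unfolding E[OF tu'(1,2)] E[OF tu'(3,4)] unfolding \<pi>_def Z by (simp add: algebra_simps)
  next
    assume *: "(\<Sum>k\<in>UNIV. E t $ k * Z $ k) = 0 \<and> (\<Sum>k\<in>UNIV. E u $ k * Z $ k) = 0"
    \<comment> \<open>Cramer's rule for the coordinates \<open>r\<close> and \<open>s\<close>, with
      the denominator \<open>\<pi> r s\<close> cleared.\<close>
    define \<alpha> where "\<alpha> = Z $ r * q $ s - Z $ s * q $ r"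
    define \<beta> where "\<beta> = p $ r * Z $ s - p $ s * Z $ r"
    have "\<pi> r s * Z $ k = \<alpha> * p $ k + \<beta> * q $ k" for k
    proof -
      have eq: "\<pi> r s * Z $ k = \<alpha> * p $ k + \<beta> * q $ k"
        if "\<pi> s k * Z $ r + \<pi> k r * Z $ s + \<pi> r s * Z $ k = 0"
      proof -
        have "\<pi> r s * Z $ k - (\<alpha> * p $ k + \<beta> * q $ k) =
            \<pi> s k * Z $ r + \<pi> k r * Z $ s + \<pi> r s * Z $ k"
          by (simp add: \<pi>_def \<alpha>_def \<beta>_def algebra_simps)
        then show ?thesis using that by simp
      qed
      consider "k = r" | "k = s" | "k = t" | "k = u" using cover by blast
      then show ?thesis
      proof cases
        case 3
        show ?thesis by (rule eq) (use * in \<open>simp only: 3 E[OF tu'(1,2)]\<close>)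
      next
        case 4
        show ?thesis by (rule eq) (use * in \<open>simp only: 4 E[OF tu'(3,4)]\<close>)
      qed (simp_all add: \<pi>_def \<alpha>_def \<beta>_def algebra_simps)
    qed
    then have "Z = (\<alpha> / \<pi> r s) *s p + (\<beta> / \<pi> r s) *s q"
      using rs by (simp add: vec_eq_iff field_simps)
    then show "Z \<in> W" using mem_W by blast
  qed
  then have "L = line_of_eqs (E t) (E u)"
    unfolding W(3) line_of_eqs_def by blast
  ultimately show thesis by (rule that)
qed

section \<open>Lines missing the fibre at infinity, as graphs over the first two coordinates\<close>

definition graph_line :: "complex \<Rightarrow> complex \<Rightarrow> complex \<Rightarrow> complex \<Rightarrow> 4 cproj set" where
  "graph_line A B C D = line_of_eqs (vec4 A (- B) (- 1) 0) (vec4 C D 0 (- 1))"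

text \<open>The sign of \<open>B\<close> is chosen so that the twistor transform is obtained by
  inserting \<open>g\<close>, \<open>hat h\<close>, \<open>h\<close>, \<open>hat g\<close> in this
  order.\<close>

lemma mem_graph_line:
  assumes "Z \<noteq> 0"
  shows "proj_class Z \<in> graph_line A B C D \<longleftrightarrow>
    Z $ 2 = A * Z $ 0 - B * Z $ 1 \<and> Z $ 3 = C * Z $ 0 + D * Z $ 1"
  unfolding graph_line_def mem_line_of_eqs[OF assms] by (auto simp: sum_4_from_0 algebra_simps)

lemma vec6_one_nonzero: "vec6 a b c d e 1 \<noteq> 0"
  by (auto simp: vec_eq_iff forall_6)

lemma klein_graph_line:
  "klein (graph_line A B C D) = proj_class (vec6 (A * D + B * C) C (- A) D B 1)"
proof -
  have "wedge (vec4 A (- B) (- 1) 0) (vec4 C D 0 (- 1)) = vec6 (A * D + B * C) C (- A) D B 1"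
    by (simp add: wedge_def vec_eq_iff forall_6)
  then show ?thesis
    by (simp add: graph_line_def klein_line_of_eqs vec6_one_nonzero)
qed

text \<open>In the chart where the sixth Klein coordinate is 1, the coefficients are themselves
  Klein coordinates up to sign.\<close>

lemma graph_line_eq_iff:
  "graph_line A B C D = graph_line A' B' C' D' \<longleftrightarrow> A = A' \<and> B = B' \<and> C = C' \<and> D = D'"
  (is "?l \<longleftrightarrow> ?r")
proof
  assume ?l
  then have "hcoord_ratio (klein (graph_line A B C D)) j 6 =
      hcoord_ratio (klein (graph_line A' B' C' D')) j 6" for j by simp
  from this[of 2] this[of 3] this[of 4] this[of 5] show ?r
    by (simp add: klein_graph_line vec6_one_nonzero)
qed simp

text \<open>The sixth coordinate of the wedge is the determinant of the two equations in the
  unknowns \<open>Z $ 2\<close> and \<open>Z $ 3\<close>, so Cramer's rule solves for them.\<close>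

lemma line_of_eqs_eq_graph_line:
  assumes ab: "a $ 2 * b $ 3 - a $ 3 * b $ 2 \<noteq> 0"
  defines "\<zeta> \<equiv> wedge a b"
  shows "line_of_eqs a b = graph_line (- (\<zeta> $ 3 / \<zeta> $ 6)) (\<zeta> $ 5 / \<zeta> $ 6) (\<zeta> $ 2 / \<zeta> $ 6) (\<zeta> $ 4 / \<zeta> $ 6)"
proof -
  define m where "m = a $ 2 * b $ 3 - a $ 3 * b $ 2"
  have m: "m \<noteq> 0" using ab by (simp add: m_def)
  have \<zeta>: "\<zeta> $ 2 = a $ 0 * b $ 2 - a $ 2 * b $ 0" "\<zeta> $ 3 = a $ 0 * b $ 3 - a $ 3 * b $ 0"
    "\<zeta> $ 4 = a $ 1 * b $ 2 - a $ 2 * b $ 1" "\<zeta> $ 5 = a $ 1 * b $ 3 - a $ 3 * b $ 1" "\<zeta> $ 6 = m"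
    by (simp_all add: \<zeta>_def wedge_def Let_def m_def)
  have "(\<Sum>k\<in>UNIV. a $ k * Z $ k) = 0 \<and> (\<Sum>k\<in>UNIV. b $ k * Z $ k) = 0 \<longleftrightarrow>
      Z $ 2 = - (\<zeta> $ 3 / \<zeta> $ 6) * Z $ 0 - \<zeta> $ 5 / \<zeta> $ 6 * Z $ 1 \<and>
      Z $ 3 = \<zeta> $ 2 / \<zeta> $ 6 * Z $ 0 + \<zeta> $ 4 / \<zeta> $ 6 * Z $ 1" for Z
  proof -
    define S T where "S = (\<Sum>k\<in>UNIV. a $ k * Z $ k)" "T = (\<Sum>k\<in>UNIV. b $ k * Z $ k)"
    have 1: "b $ 3 * S - a $ 3 * T = \<zeta> $ 3 * Z $ 0 + \<zeta> $ 5 * Z $ 1 + m * Z $ 2"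
      "a $ 2 * T - b $ 2 * S = - \<zeta> $ 2 * Z $ 0 - \<zeta> $ 4 * Z $ 1 + m * Z $ 3"
      by (simp_all add: S_T_def sum_4_from_0 \<zeta> m_def algebra_simps)
    \<comment> \<open>The elimination is undone up to the nonzero factor \<open>m\<close>, so no
      solutions were added.\<close>
    have "m * S = a $ 2 * (b $ 3 * S - a $ 3 * T) + a $ 3 * (a $ 2 * T - b $ 2 * S)"
      "m * T = b $ 2 * (b $ 3 * S - a $ 3 * T) + b $ 3 * (a $ 2 * T - b $ 2 * S)"
      by (simp_all add: m_def algebra_simps)
    then have "S = 0 \<and> T = 0 \<longleftrightarrow> b $ 3 * S - a $ 3 * T = 0 \<and> a $ 2 * T - b $ 2 * S = 0"
      using m by auto
    also have "\<dots> \<longleftrightarrow> m * Z $ 2 = - \<zeta> $ 3 * Z $ 0 - \<zeta> $ 5 * Z $ 1 \<and>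
        m * Z $ 3 = \<zeta> $ 2 * Z $ 0 + \<zeta> $ 4 * Z $ 1"
      unfolding 1 by (auto simp: algebra_simps eq_neg_iff_add_eq_0)
    also have "\<dots> \<longleftrightarrow> Z $ 2 = - (\<zeta> $ 3 / m) * Z $ 0 - \<zeta> $ 5 / m * Z $ 1 \<and>
        Z $ 3 = \<zeta> $ 2 / m * Z $ 0 + \<zeta> $ 4 / m * Z $ 1"
      using m by (simp add: field_simps)
    finally show ?thesis by (simp add: S_T_def \<zeta>(5))
  qed
  note eqs = this
  show ?thesis
  proof (intro set_eqI)
    fix P :: "4 cproj"
    obtain Z where Z: "Z \<noteq> 0" "P = proj_class Z" by (rule cproj_cases)
    show "P \<in> line_of_eqs a b \<longleftrightarrow> P \<in> graph_line (- (\<zeta> $ 3 / \<zeta> $ 6)) (\<zeta> $ 5 / \<zeta> $ 6)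
        (\<zeta> $ 2 / \<zeta> $ 6) (\<zeta> $ 4 / \<zeta> $ 6)"
      unfolding Z(2) mem_graph_line[OF Z(1)] mem_line_of_eqs[OF Z(1)] by (rule eqs)
  qed
qed

lemma Gr2_eq_graph_line:
  assumes L: "L \<in> Gr2" and nz: "hcoord_nonzero (klein L) 6"
  shows "L = graph_line (- hcoord_ratio (klein L) 3 6) (hcoord_ratio (klein L) 5 6)
    (hcoord_ratio (klein L) 2 6) (hcoord_ratio (klein L) 4 6)"
proof -
  obtain a b where ab: "wedge a b \<noteq> 0" "L = line_of_eqs a b" using L by (rule Gr2_line_of_eqs)
  then have k: "klein L = proj_class (wedge a b)" by (simp add: klein_line_of_eqs)
  with nz ab have "wedge a b $ 6 \<noteq> 0" by simp
  then have "a $ 2 * b $ 3 - a $ 3 * b $ 2 \<noteq> 0" by (simp add: wedge_def Let_def)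
  from line_of_eqs_eq_graph_line[OF this] show ?thesis
    unfolding k hcoord_ratio_proj_class[OF ab(1)] ab(2)[symmetric] .
qed

lemma graph_line_Gr2: "graph_line A B C D \<in> Gr2"
proof -
  \<comment> \<open>The points of the graph over the two unit vectors, which form a basis of the
    subspace.\<close>
  define p q where "p = vec4 1 0 A C" "q = vec4 0 1 (- B) D"
  have neq: "p \<noteq> q" by (auto simp: p_q_def vec4_eq_iff)
  have sp: "Z \<in> vec.span {p, q} \<longleftrightarrow> (\<exists>\<alpha> \<beta>. Z - \<alpha> *s p = \<beta> *s q)" for Z
    unfolding vec.span_insert vec.span_singleton by auto
  have mem: "Z \<in> vec.span {p, q} \<longleftrightarrow> Z $ 2 = A * Z $ 0 - B * Z $ 1 \<and> Z $ 3 = C * Z $ 0 + D * Z $ 1" for Z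
  proof
    assume "Z \<in> vec.span {p, q}"
    then show "Z $ 2 = A * Z $ 0 - B * Z $ 1 \<and> Z $ 3 = C * Z $ 0 + D * Z $ 1"
      unfolding sp by (auto simp: p_q_def vec_eq_iff forall_4_from_0 algebra_simps)
  next
    assume "Z $ 2 = A * Z $ 0 - B * Z $ 1 \<and> Z $ 3 = C * Z $ 0 + D * Z $ 1"
    then show "Z \<in> vec.span {p, q}"
      unfolding sp by (intro exI[of _ "Z $ 0"] exI[of _ "Z $ 1"])
        (auto simp: p_q_def vec_eq_iff forall_4_from_0 algebra_simps)
  qed
  have "vec.independent {p, q}"
  proof -
    have "q \<noteq> 0" by (auto simp: p_q_def vec_eq_iff forall_4_from_0)
    moreover have "p \<notin> vec.span {q}"
      unfolding vec.span_singleton by (auto simp: p_q_def vec_eq_iff forall_4_from_0)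
    ultimately show ?thesis using neq by (simp add: vec.independent_insert)
  qed
  then have "vec.dim (vec.span {p, q}) = 2"
    using neq vec.dim_eq_card_independent[of "{p, q}"] by simp
  moreover have "graph_line A B C D = {proj_class Z | Z. Z \<in> vec.span {p, q} \<and> Z \<noteq> 0}"
  proof (intro set_eqI iffI)
    fix P assume "P \<in> graph_line A B C D"
    moreover obtain Z where Z: "Z \<noteq> 0" "P = proj_class Z" by (rule cproj_cases)
    ultimately show "P \<in> {proj_class Z | Z. Z \<in> vec.span {p, q} \<and> Z \<noteq> 0}"
      by (auto simp: mem_graph_line mem)
  qed (auto simp: mem_graph_line mem)
  ultimately show ?thesis
    unfolding Gr2_def using vec.subspace_span by blast
qed

text \<open>The parameter is \<open>u = Z $ 1 / Z $ 0\<close>, with the extra point for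
  \<open>Z $ 0 = 0\<close>: the same parametrisation that the twistor lift uses on
  \<open>ell v\<close>.\<close>

lemma graph_line_points:
  "graph_line A B C D = insert (proj_class (vec4 0 1 (- B) D))
     (range (\<lambda>u. proj_class (vec4 1 u (A - u * B) (C + u * D))))" (is "_ = ?R")
proof (intro set_eqI iffI)
  fix P assume P: "P \<in> graph_line A B C D"
  obtain Z where Z: "Z \<noteq> 0" "P = proj_class Z" by (rule cproj_cases)
  have eqs: "Z $ 2 = A * Z $ 0 - B * Z $ 1" "Z $ 3 = C * Z $ 0 + D * Z $ 1"
    using P by (simp_all add: Z mem_graph_line)
  show "P \<in> ?R"
  proof (cases "Z $ 0 = 0")
    case True
    have "Z = Z $ 1 *s vec4 0 1 (- B) D"
      using eqs True by (simp add: vec_eq_iff forall_4_from_0)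
    moreover have "vec4 0 1 (- B) D \<noteq> 0" by (auto simp: vec_eq_iff forall_4_from_0)
    ultimately have "P = proj_class (vec4 0 1 (- B) D)"
      using Z proj_class_eq_iff by metis
    then show ?thesis by blast
  next
    case False
    define u where "u = Z $ 1 / Z $ 0"
    have "Z $ 1 = u * Z $ 0" using False by (simp add: u_def)
    then have "Z = Z $ 0 *s vec4 1 u (A - u * B) (C + u * D)"
      using eqs by (simp add: vec_eq_iff forall_4_from_0 algebra_simps)
    moreover have "vec4 1 u (A - u * B) (C + u * D) \<noteq> 0" by (auto simp: vec_eq_iff forall_4_from_0)
    ultimately have "P = proj_class (vec4 1 u (A - u * B) (C + u * D))"
      using Z proj_class_eq_iff by metis
    then show ?thesis by blast
  qed
next
  fix P assume "P \<in> ?R"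
  moreover have "vec4 0 1 (- B) D \<noteq> 0" "vec4 1 u (A - u * B) (C + u * D) \<noteq> 0" for u
    by (auto simp: vec_eq_iff forall_4_from_0)
  ultimately show "P \<in> graph_line A B C D" by (auto simp: mem_graph_line algebra_simps)
qed


section \<open>The twistor transform\<close>

text \<open>This and the next two lemmas show that a point determines its parameters, which makes
  the definite description in \<open>twistor_lift\<close> well defined.\<close>

lemma ell_pt_eq_iff: "ell_pt v u = ell_pt v' u' \<longleftrightarrow> v = v' \<and> u = u'"
proof
  assume "ell_pt v u = ell_pt v' u'"
  moreover have "vec4 1 u v (u * v) \<noteq> 0" for u v by (auto simp: vec_eq_iff forall_4_from_0)
  ultimately obtain c where "vec4 1 u' v' (u' * v') = c *s vec4 1 u v (u * v)"
    unfolding ell_pt_def using proj_class_eq_iff by metis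
  then show "v = v' \<and> u = u'" by (simp add: vec_eq_iff forall_4_from_0)
qed simp

lemma ell_pt_inf_eq_iff: "ell_pt_inf v = ell_pt_inf v' \<longleftrightarrow> v = v'"
proof
  assume "ell_pt_inf v = ell_pt_inf v'"
  moreover have "vec4 0 1 0 v \<noteq> 0" for v by (auto simp: vec_eq_iff forall_4_from_0)
  ultimately obtain c where "vec4 0 1 0 v' = c *s vec4 0 1 0 v"
    unfolding ell_pt_inf_def using proj_class_eq_iff by metis
  then show "v = v'" by (simp add: vec_eq_iff forall_4_from_0)
qed simp

lemma ell_pt_neq_inf: "ell_pt v u \<noteq> ell_pt_inf v'"
proof
  assume *: "ell_pt v u = ell_pt_inf v'"
  moreover have "vec4 0 1 0 v' \<noteq> 0" "vec4 1 u v (u * v) \<noteq> 0" by (auto simp: vec_eq_iff forall_4_from_0)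
  ultimately obtain c where "vec4 1 u v (u * v) = c *s vec4 0 1 0 v'"
    unfolding ell_pt_inf_def ell_pt_def using proj_class_eq_iff by metis
  then show False by (simp add: vec_eq_iff forall_4_from_0)
qed

lemma twistor_transform_eq_graph_line:
  fixes f :: "quat \<Rightarrow> quat"
  assumes v: "v \<in> upper_slice \<Omega>"
  defines "g \<equiv> \<lambda>v. fst_comp (f (quat_of_complex v))"
    and "h \<equiv> \<lambda>v. snd_comp (f (quat_of_complex v))"
  shows "twistor_transform \<Omega> f v = graph_line (g v) (hat h v) (h v) (hat g v)"
proof -
  have "twistor_lift \<Omega> f (ell_pt v u) = proj_class (vec4 1 u (g v - u * hat h v) (h v + u * hat g v))" for u
    unfolding twistor_lift_def Let_def g_def h_def
    by (rule the_equality) (use v in \<open>auto simp: ell_pt_eq_iff ell_pt_neq_inf\<close>)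
  moreover have "twistor_lift \<Omega> f (ell_pt_inf v) = proj_class (vec4 0 1 (- hat h v) (hat g v))"
    unfolding twistor_lift_def Let_def g_def h_def
    by (rule the_equality) (use v in \<open>auto simp: ell_pt_inf_eq_iff ell_pt_neq_inf[symmetric]\<close>)
  ultimately show ?thesis
    by (simp add: twistor_transform_def ell_def graph_line_points image_image)
qed

section \<open>Passage between regular functions and real holomorphic curves\<close>

lemma
  assumes dom: "symmetric_slice_domain \<Omega>" and f: "slice_regular_on \<Omega> f"
  shows holomorphic_fst_comp: "(\<lambda>z. fst_comp (f (quat_of_complex z))) holomorphic_on complex_slice \<Omega>"
    and holomorphic_snd_comp: "(\<lambda>z. snd_comp (f (quat_of_complex z))) holomorphic_on complex_slice \<Omega>"
  using holomorphic_slice_comp[OF dom f imag_unit_i]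
  by (simp_all add: fst_comp_eq_slice_comp snd_comp_eq_slice_comp slice_pt_i)

lemma holomorphic_hat:
  assumes dom: "symmetric_slice_domain \<Omega>" and g: "g holomorphic_on complex_slice \<Omega>"
  shows "hat g holomorphic_on complex_slice \<Omega>"
proof -
  have "cnj ` complex_slice \<Omega> = complex_slice \<Omega>"
    using cnj_mem_complex_slice[OF dom] by (force intro: image_eqI[of _ _ "cnj _"])
  then have "cnj \<circ> g \<circ> cnj holomorphic_on complex_slice \<Omega>"
    using g by (intro holomorphic_on_compose_cnj_cnj) (simp_all add: open_complex_slice[OF dom])
  then show ?thesis by (simp add: hat_def[abs_def] o_def)
qed

text \<open>The sixth Klein coordinate is constantly 1, so a single chart covers the curve; reality
  holds because applying \<open>hat\<close> twice gives back the function.\<close>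

lemma real_holomorphic_curve_graph_line:
  assumes dom: "symmetric_slice_domain \<Omega>"
    and g: "g holomorphic_on complex_slice \<Omega>" and h: "h holomorphic_on complex_slice \<Omega>"
  shows "real_holomorphic_curve (complex_slice \<Omega>) (\<lambda>v. graph_line (g v) (hat h v) (h v) (hat g v))"
proof -
  have "(\<lambda>v. hcoord_ratio (klein (graph_line (g v) (hat h v) (h v) (hat g v))) j 6)
      holomorphic_on complex_slice \<Omega>" for j
  proof -
    have "\<forall>j. (\<lambda>v. vec6 (g v * hat g v + hat h v * h v) (h v) (- g v) (hat g v) (hat h v) 1 $ j)
        holomorphic_on complex_slice \<Omega>"
      unfolding forall_6 vec6_nth
      by (intro conjI holomorphic_intros g h holomorphic_hat[OF dom])
    then show ?thesis by (simp add: klein_graph_line vec6_one_nonzero)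
  qed
  then have "holomorphic_curve (complex_slice \<Omega>) (\<lambda>v. graph_line (g v) (hat h v) (h v) (hat g v))"
    unfolding holomorphic_curve_def holomorphic_into_cproj_def
    using open_complex_slice[OF dom] graph_line_Gr2
    by (intro conjI ballI exI[of _ "complex_slice \<Omega>"] exI[of _ 6])
      (auto simp: klein_graph_line vec6_one_nonzero)
  then show ?thesis
    by (simp add: real_holomorphic_curve_def klein_graph_line sigma_P5_proj_class vec6_one_nonzero
        hat_def algebra_simps)
qed

text \<open>Two of the four coefficients define \<open>g\<close> and \<open>h\<close>; the reality
  condition at \<open>v\<close> identifies the other two as \<open>hat g\<close> and
  \<open>hat h\<close>.\<close>

lemma graph_line_of_real_holomorphic_curve:
  assumes dom: "symmetric_slice_domain \<Omega>"
    and G: "real_holomorphic_curve (complex_slice \<Omega>) G"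
    and nz: "\<And>v. v \<in> complex_slice \<Omega> \<Longrightarrow> hcoord_nonzero (klein (G v)) 6"
  obtains g h where "g holomorphic_on complex_slice \<Omega>" "h holomorphic_on complex_slice \<Omega>"
    "\<And>v. v \<in> complex_slice \<Omega> \<Longrightarrow> G v = graph_line (g v) (hat h v) (h v) (hat g v)"
proof
  define g where "g v = - hcoord_ratio (klein (G v)) 3 6" for v
  define h where "h v = hcoord_ratio (klein (G v)) 2 6" for v
  have hol: "holomorphic_into_cproj (complex_slice \<Omega>) (\<lambda>v. klein (G v))"
    and Gr: "\<And>v. v \<in> complex_slice \<Omega> \<Longrightarrow> G v \<in> Gr2"
    and real: "\<And>v. v \<in> complex_slice \<Omega> \<Longrightarrow> klein (G (cnj v)) = sigma_P5 (klein (G v))"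
    using G by (auto simp: real_holomorphic_curve_def holomorphic_curve_def)
  show "g holomorphic_on complex_slice \<Omega>" "h holomorphic_on complex_slice \<Omega>"
    unfolding g_def h_def
    by (intro holomorphic_intros holomorphic_hcoord_ratio[OF hol nz]; assumption)+
  show "G v = graph_line (g v) (hat h v) (h v) (hat g v)" if v: "v \<in> complex_slice \<Omega>" for v
    using Gr2_eq_graph_line[OF Gr nz, OF v v]
    by (simp add: hat_def g_def h_def real[OF v] hcoord_ratio_sigma_P5)
qed

theorem theorem5p7:
  fixes \<Omega> :: "quat set"
  assumes "symmetric_slice_domain \<Omega>"
  shows "(\<forall>f. slice_regular_on \<Omega> f \<longrightarrow>
            (\<exists>G. real_holomorphic_curve (complex_slice \<Omega>) G \<and>
                 (\<forall>v\<in>upper_slice \<Omega>. G v = twistor_transform \<Omega> f v \<and>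
                    klein (G (cnj v)) = sigma_P5 (klein (twistor_transform \<Omega> f v))))) \<and>
         (\<forall>G. real_holomorphic_curve (complex_slice \<Omega>) G \<and>
              (\<forall>v\<in>complex_slice \<Omega>. hcoord_nonzero (klein (G v)) 6) \<longrightarrow>
            (\<exists>f. slice_regular_on \<Omega> f \<and>
                 (\<forall>v\<in>upper_slice \<Omega>. G v = twistor_transform \<Omega> f v) \<and>
                 (\<forall>f'. slice_regular_on \<Omega> f' \<and>
                       (\<forall>v\<in>upper_slice \<Omega>. G v = twistor_transform \<Omega> f' v) \<longrightarrow>
                       (\<forall>q\<in>\<Omega>. f' q = f q))))"
proof (intro conjI allI impI)
  fix f assume f: "slice_regular_on \<Omega> f"
  define g where "g v = fst_comp (f (quat_of_complex v))" for v
  define h where "h v = snd_comp (f (quat_of_complex v))" for v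
  let ?G = "\<lambda>v. graph_line (g v) (hat h v) (h v) (hat g v)"
  have "g holomorphic_on complex_slice \<Omega>" "h holomorphic_on complex_slice \<Omega>"
    using holomorphic_fst_comp[OF assms f] holomorphic_snd_comp[OF assms f]
    by (simp_all add: g_def[abs_def] h_def[abs_def])
  then have real: "real_holomorphic_curve (complex_slice \<Omega>) ?G"
    by (rule real_holomorphic_curve_graph_line[OF assms])
  have tw: "?G v = twistor_transform \<Omega> f v" if "v \<in> upper_slice \<Omega>" for v
    unfolding twistor_transform_eq_graph_line[OF that] by (simp only: g_def[abs_def] h_def[abs_def])
  have "klein (?G (cnj v)) = sigma_P5 (klein (twistor_transform \<Omega> f v))" if "v \<in> upper_slice \<Omega>" for v
    using real that unfolding tw[OF that, symmetric]
    by (auto simp: real_holomorphic_curve_def upper_slice_def)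
  with real tw show "\<exists>G. real_holomorphic_curve (complex_slice \<Omega>) G \<and>
      (\<forall>v\<in>upper_slice \<Omega>. G v = twistor_transform \<Omega> f v \<and>
        klein (G (cnj v)) = sigma_P5 (klein (twistor_transform \<Omega> f v)))"
    by (intro exI[of _ ?G]) blast
next
  fix G
  assume "real_holomorphic_curve (complex_slice \<Omega>) G \<and>
    (\<forall>v\<in>complex_slice \<Omega>. hcoord_nonzero (klein (G v)) 6)"
  then obtain g h where hol: "g holomorphic_on complex_slice \<Omega>" "h holomorphic_on complex_slice \<Omega>"
    and G: "\<And>v. v \<in> complex_slice \<Omega> \<Longrightarrow> G v = graph_line (g v) (hat h v) (h v) (hat g v)"
    using graph_line_of_real_holomorphic_curve[OF assms, of G] by metis
  define f where "f = regular_ext (\<lambda>z. quat_of_complex (g z) + quat_of_complex (h z) * quat_j)"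
  have f: "slice_regular_on \<Omega> f"
    unfolding f_def by (rule slice_regular_regular_ext[OF assms hol])
  have comp: "fst_comp (f (quat_of_complex z)) = g z" "snd_comp (f (quat_of_complex z)) = h z" for z
    unfolding f_def regular_ext_complex
    by (simp_all add: fst_comp_def snd_comp_def quat_of_complex_def quat_j_def
        times_quat_def)
  have tw: "G v = twistor_transform \<Omega> f v" if "v \<in> upper_slice \<Omega>" for v
    using that by (simp add: twistor_transform_eq_graph_line comp G upper_slice_def)
  have "f' q = f q" if f': "slice_regular_on \<Omega> f'"
    and tw': "\<forall>v\<in>upper_slice \<Omega>. G v = twistor_transform \<Omega> f' v" and q: "q \<in> \<Omega>" for f' q
  proof (rule slice_regular_eqI[OF assms f' f _ q])
    \<comment> \<open>Equal lines have equal graph coefficients, and two of these are the complex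
      components of the function at \<open>v\<close>.\<close>
    fix v assume v: "v \<in> upper_slice \<Omega>"
    with tw tw' have "twistor_transform \<Omega> f' v = twistor_transform \<Omega> f v" by metis
    then have "fst_comp (f' (quat_of_complex v)) = fst_comp (f (quat_of_complex v))"
      "snd_comp (f' (quat_of_complex v)) = snd_comp (f (quat_of_complex v))"
      unfolding twistor_transform_eq_graph_line[OF v] graph_line_eq_iff by auto
    then show "f' (quat_of_complex v) = f (quat_of_complex v)" by (metis quat_split)
  qed
  with f tw show "\<exists>f. slice_regular_on \<Omega> f \<and> (\<forall>v\<in>upper_slice \<Omega>. G v = twistor_transform \<Omega> f v) \<and>
      (\<forall>f'. slice_regular_on \<Omega> f' \<and> (\<forall>v\<in>upper_slice \<Omega>. G v = twistor_transform \<Omega> f' v) \<longrightarrow>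
        (\<forall>q\<in>\<Omega>. f' q = f q))"
    by (intro exI[of _ f]) blast
qed

end
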